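(* Let $\{Y(t),t\in\mathbb{R}^d\}$ be a real-valued measurable centered Gaussian random field with $\sigma^2(t)=\mathbf{E}[Y(t)^2]$ and correlation function $\rho(t,s)=\mathrm{Corr}(Y(t),Y(s))$, $t,s\in\mathbb{R}^d$. Let $f:\mathbb{R}\to\mathbb{R}$ be Borel-measurable and let $X(t)=f(Y(t))$, $t\in\mathbb{R}^d$. Let $(W_n)_{n\in\mathbb{N}}$ be a van Hove sequence of observation windows in $\mathbb{R}^d$. Fix $u\in\mathbb{R}$ and put $$a_1(t)=\langle H_1,\mathbf{1}\{f(\sigma(t)\,\cdot)\ge u\}\rangle_{\varphi}=\int_{\mathbb{R}}x\,\mathbf{1}\{f(\sigma(t)x)\ge u\}\varphi(x)\,dx .$$ Suppose there exists a set $U$ with $U\subset W_n$ for all $n\ge1$, $\nu_d(U)>0$, and $a_1(t)\neq0$ for all $t\in U$. If $$\lim_{n\to\infty}\frac{\int_{W_n}\int_{W_n}\rho^2(t,s)\,\nu_d(dt)\,\nu_d(ds)}{\int_{W_n}\int_{W_n}a_1(t)a_1(s)\rho(t,s)\,\nu_d(dt)\,\nu_d(ds)}=0,$$ then, as $n\to\infty$, $$\frac{\int_{W_n}\mathbf{1}\{X(t)\ge u\}\,\nu_d(dt)-\int_{W_n}\mathbb{P}(X(t)\ge u)\,\nu_d(dt)}{\left(\int_{W_n}\int_{W_n}a_1(t)a_1(s)\rho(t,s)\,\nu_d(dt)\,\nu_d(ds)\right)^{1/2}}\xrightarrow{d}N(0,1).$$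
   Context: $\nu_d$ is Lebesgue measure on $\mathbb{R}^d$; $\varphi(x)=\frac{1}{\sqrt{2\pi}}e^{-x^2/2}$; $\langle G_1,G_2\rangle_\varphi=\int_{\mathbb{R}}G_1(x)G_2(x)\varphi(x)\,dx$; $H_1(x)=x$ is the first Hermite polynomial. $\sigma(t)=\sqrt{\sigma^2(t)}>0$ (so that the correlation is defined). A sequence $(W_n)$ of compact subsets of $\mathbb{R}^d$ is a van Hove sequence if $\nu_d(W_n)\to\infty$ and, for every $r>0$, $\nu_d(\partial W_n\oplus B_r(0))/\nu_d(W_n)\to0$ as $n\to\infty$, where $\partial W_n$ is the boundary, $\oplus$ is the Minkowski sum and $B_r(0)=\{x:\|x\|<r\}$. $\xrightarrow{d}$ denotes convergence in distribution. *)

theory Defs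
  imports "HOL-Probability.Probability"
begin

text \<open>Minkowski sums are written out as a set comprehension; \<open>ball 0 r\<close> is the open ball.
  The sequence is indexed by \<open>n \<ge> 1\<close>, so the value at 0 is irrelevant.\<close>

definition van_hove :: "(nat \<Rightarrow> (real ^ 'd::finite) set) \<Rightarrow> bool" where
  "van_hove W \<longleftrightarrow>
     (\<forall>n\<ge>1. compact (W n)) \<and>
     filterlim (\<lambda>n. measure lborel (W n)) at_top sequentially \<and>
     (\<forall>r>0. (\<lambda>n. measure lborel {x + y | x y. x \<in> frontier (W n) \<and> y \<in> ball 0 r}
               / measure lborel (W n)) \<longlonglongrightarrow> 0)"

text \<open>Normal laws may be degenerate (variance zero); this case has to be listed separately because
  \<^term>\<open>normal_density \<mu> 0\<close> is not a probability density.\<close>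

definition gaussian_rv :: "'w measure \<Rightarrow> ('w \<Rightarrow> real) \<Rightarrow> bool" where
  "gaussian_rv M Z \<longleftrightarrow>
     Z \<in> borel_measurable M \<and>
     ((\<exists>\<mu>. AE \<omega> in M. Z \<omega> = \<mu>) \<or>
      (\<exists>\<mu> \<sigma>. \<sigma> > 0 \<and> distributed M lborel Z (normal_density \<mu> \<sigma>)))"

text \<open>All finite-dimensional distributions are (possibly degenerate) multivariate normal, i.e. every
  finite linear combination of the field is a normal variable.\<close>

definition gaussian_field :: "'w measure \<Rightarrow> ('t \<Rightarrow> 'w \<Rightarrow> real) \<Rightarrow> bool" where
  "gaussian_field M Y \<longleftrightarrow>
     (\<forall>T c. finite T \<longrightarrow> gaussian_rv M (\<lambda>\<omega>. \<Sum>t\<in>T. c t * Y t \<omega>))"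

definition measurable_field ::
    "'w measure \<Rightarrow> ('t::topological_space \<Rightarrow> 'w \<Rightarrow> real) \<Rightarrow> bool" where
  "measurable_field M Y \<longleftrightarrow> (\<lambda>(t, \<omega>). Y t \<omega>) \<in> borel_measurable (borel \<Otimes>\<^sub>M M)"

definition covariance :: "'w measure \<Rightarrow> ('w \<Rightarrow> real) \<Rightarrow> ('w \<Rightarrow> real) \<Rightarrow> real" where
  "covariance M A B =
     (LINT \<omega>|M. (A \<omega> - (LINT \<eta>|M. A \<eta>)) * (B \<omega> - (LINT \<eta>|M. B \<eta>)))"

definition correlation :: "'w measure \<Rightarrow> ('w \<Rightarrow> real) \<Rightarrow> ('w \<Rightarrow> real) \<Rightarrow> real" where
  "correlation M A B = covariance M A B / sqrt (covariance M A A * covariance M B B)"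

definition hermite1 :: "real \<Rightarrow> real" where
  "hermite1 x = x"

definition gauss_inner :: "(real \<Rightarrow> real) \<Rightarrow> (real \<Rightarrow> real) \<Rightarrow> real" where
  "gauss_inner G1 G2 = (LINT x|lborel. G1 x * G2 x * std_normal_density x)"

end

theory Submission
  imports Defs
begin

text \<open>
  Put \<open>Z t = Y t / \<sigma> t\<close>, a standard normal variable for every \<open>t\<close>. Subtracting from the
  centered indicator \<open>1{X t \<ge> u} - P(X t \<ge> u)\<close> its projection \<open>a1 t * Z t\<close> on the first
  Hermite polynomial leaves a remainder that is orthogonal to all affine functions of \<open>Z t\<close>.
  Integrating over the window splits the normalised excursion volume into a linear part and a remainder
  part.

  The linear part \<open>\<integral> a1 t * Z t dt\<close> is exactly normal, and its variance is the double integral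
  \<open>D\<close> under the root in the denominator. Hence the linear part divided by \<open>sqrt D\<close> is exactly
  standard normal; no limit is involved. (As a variance, \<open>D\<close> is positive as soon as it does not
  vanish.) That an integral of a Gaussian field is normal
  (\<open>gaussian_char_path_integral\<close>) is shown by a Monte Carlo argument: points of the window can be
  chosen one after the other, each not positively correlated with the error made so far, so that the
  averages over \<open>N\<close> points, which are finite linear combinations of the field, converge in \<open>L\<^sup>2\<close> to
  the integral, with mean square error of order \<open>1/N\<close>.

  The remainder part is negligible. The remainders at \<open>t\<close> and \<open>s\<close> have covariance at most
  \<open>2000 * \<rho>(t, s)\<^sup>2\<close> (\<open>rank_two_covariance_bound\<close>): Hermite rank two makes the constant and
  the linear term in \<open>\<rho>\<close> vanish. For \<open>\<bar>\<rho>\<bar> \<le> 1/4\<close> this follows from a second order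
  expansion of the bivariate normal density in \<open>\<rho>\<close>, uniform up to a Gaussian weight
  (\<open>mehler_expansion\<close>); for larger \<open>\<bar>\<rho>\<bar>\<close> a bound on second moments is enough. So the
  remainder part divided by \<open>sqrt D\<close> has second moment at most 2000 times the quotient that is assumed
  to tend to 0, and an \<open>L\<^sup>2\<close>-small perturbation changes a characteristic function only slightly
  (\<open>char_diff_bound\<close>). The Levy continuity theorem concludes.
\<close>

section \<open>Centered Gaussian variables and their characteristic functions\<close>

lemma gaussian_rv_standardize:
  assumes "prob_space M" "gaussian_rv M Z" "(LINT \<omega>|M. Z \<omega>) = 0"
  shows "(AE \<omega> in M. Z \<omega> = 0) \<or>
         (\<exists>\<sigma>>0. distr M borel (\<lambda>\<omega>. Z \<omega> / \<sigma>) = std_normal_distribution)"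
proof -
  interpret prob_space M by fact
  have [measurable]: "Z \<in> borel_measurable M"
    using assms(2) by (simp add: gaussian_rv_def)
  consider (deg) \<mu> where "AE \<omega> in M. Z \<omega> = \<mu>"
    | (normal) \<mu> \<sigma> where "\<sigma> > 0" "distributed M lborel Z (normal_density \<mu> \<sigma>)"
    using assms(2) unfolding gaussian_rv_def by blast
  then show ?thesis
  proof cases
    case deg
    have "(LINT \<omega>|M. Z \<omega>) = (LINT \<omega>|M. \<mu>)"
      using deg by (intro integral_cong_AE) auto
    then have "\<mu> = 0" using assms(3) by (simp add: prob_space)
    then show ?thesis using deg by blast
  next
    case normal
    have "\<mu> = 0" using normal_distributed_expectation[OF normal] assms(3) by simp
    then have "distributed M lborel (\<lambda>\<omega>. Z \<omega> / \<sigma>) std_normal_density"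
      using normal normal_standard_normal_convert[OF normal(1), of Z \<mu>] by simp
    then have "distr M lborel (\<lambda>\<omega>. Z \<omega> / \<sigma>) = std_normal_distribution"
      by (rule distributed_distr_eq_density[symmetric, THEN sym])
    moreover have "distr M lborel (\<lambda>\<omega>. Z \<omega> / \<sigma>) = distr M borel (\<lambda>\<omega>. Z \<omega> / \<sigma>)"
      by (rule distr_cong) auto
    ultimately show ?thesis using normal(1) by auto
  qed
qed

lemma gaussian_rv_centered:
  assumes "prob_space M" "gaussian_rv M Z" "(LINT \<omega>|M. Z \<omega>) = 0"
  shows gaussian_rv_square_integrable: "integrable M (\<lambda>\<omega>. (Z \<omega>)\<^sup>2)"
    and gaussian_rv_char: "(CLINT \<omega>|M. iexp (s * Z \<omega>))
           = complex_of_real (exp (- s\<^sup>2 * (LINT \<omega>|M. (Z \<omega>)\<^sup>2) / 2))"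
proof -
  interpret prob_space M by fact
  have Z[measurable]: "Z \<in> borel_measurable M"
    using assms(2) by (simp add: gaussian_rv_def)
  have "integrable M (\<lambda>\<omega>. (Z \<omega>)\<^sup>2) \<and> (CLINT \<omega>|M. iexp (s * Z \<omega>))
           = complex_of_real (exp (- s\<^sup>2 * (LINT \<omega>|M. (Z \<omega>)\<^sup>2) / 2))"
    using gaussian_rv_standardize[OF assms]
  proof (elim disjE exE conjE)
    assume *: "AE \<omega> in M. Z \<omega> = 0"
    have "integrable M (\<lambda>\<omega>. (Z \<omega>)\<^sup>2) \<longleftrightarrow> integrable M (\<lambda>\<omega>. 0::real)"
      using * by (intro integrable_cong_AE) auto
    moreover have "(LINT \<omega>|M. (Z \<omega>)\<^sup>2) = (LINT \<omega>|M. 0)"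
      using * by (intro integral_cong_AE) auto
    moreover have "(CLINT \<omega>|M. iexp (s * Z \<omega>)) = (CLINT \<omega>|M. 1)"
      using * by (intro integral_cong_AE) auto
    ultimately show ?thesis by (simp add: prob_space)
  next
    fix \<sigma> :: real assume \<sigma>: "\<sigma> > 0"
      and d: "distr M borel (\<lambda>\<omega>. Z \<omega> / \<sigma>) = std_normal_distribution"
    have "integrable (distr M borel (\<lambda>\<omega>. Z \<omega> / \<sigma>)) (\<lambda>x. x\<^sup>2)"
      unfolding d by (rule integrable_std_normal_distribution_moment)
    then have "integrable M (\<lambda>\<omega>. (Z \<omega> / \<sigma>)\<^sup>2)"
      by (subst (asm) integrable_distr_eq) auto
    then have "integrable M (\<lambda>\<omega>. \<sigma>\<^sup>2 * (Z \<omega> / \<sigma>)\<^sup>2)" by (rule integrable_mult_right)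
    then have i: "integrable M (\<lambda>\<omega>. (Z \<omega>)\<^sup>2)" using \<sigma> by (simp add: power_divide)
    have "(LINT x|distr M borel (\<lambda>\<omega>. Z \<omega> / \<sigma>). x\<^sup>2) = 1"
      unfolding d using std_normal_distribution_even_moments(1)[of 1] by simp
    then have "(LINT \<omega>|M. (Z \<omega> / \<sigma>)\<^sup>2) = 1"
      by (subst (asm) integral_distr) auto
    then have v: "(LINT \<omega>|M. (Z \<omega>)\<^sup>2) = \<sigma>\<^sup>2"
      using \<sigma> by (simp add: power_divide)
    have "char (distr M borel (\<lambda>\<omega>. Z \<omega> / \<sigma>)) (s * \<sigma>) = (CLINT \<omega>|M. iexp (s * Z \<omega>))"
      unfolding char_def using \<sigma> by (subst integral_distr) (auto simp: mult.assoc)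
    then show ?thesis
      unfolding d v char_std_normal_distribution using i by (auto simp: power_mult_distrib)
  qed
  then show "integrable M (\<lambda>\<omega>. (Z \<omega>)\<^sup>2)"
    and "(CLINT \<omega>|M. iexp (s * Z \<omega>))
           = complex_of_real (exp (- s\<^sup>2 * (LINT \<omega>|M. (Z \<omega>)\<^sup>2) / 2))" by auto
qed

section \<open>Independence of uncorrelated jointly normal variables\<close>

text \<open>
  One-dimensional Levy uniqueness under a change of measure: \<open>h / c\<close> is a probability density with
  respect to \<open>M\<close>, and under it \<open>Z\<close> has the standard normal characteristic function. Applied with
  varying weights \<open>h\<close>, it yields the uniqueness in the plane that is needed for independence.
\<close>

lemma std_normal_of_weighted_char:
  fixes h Z :: "'w \<Rightarrow> real" and c :: real
  assumes Z[measurable]: "Z \<in> borel_measurable M" and h: "integrable M h"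
    and nn: "\<And>\<omega>. h \<omega> \<ge> 0"
    and char: "\<And>s. (CLINT \<omega>|M. h \<omega> * iexp (s * Z \<omega>)) = complex_of_real (c * exp (- s\<^sup>2 / 2))"
    and B[measurable]: "B \<in> sets borel"
  shows "(LINT \<omega>|M. h \<omega> * indicator B (Z \<omega>)) = c * measure std_normal_distribution B"
proof -
  have [measurable]: "h \<in> borel_measurable M" using h by auto
  have "complex_of_real (LINT \<omega>|M. h \<omega>) = complex_of_real c"
    using char[of 0] by simp
  then have c: "(LINT \<omega>|M. h \<omega>) = c" by (simp only: of_real_eq_iff)
  show ?thesis
  proof (cases "c = 0")
    case True
    then have "AE \<omega> in M. h \<omega> = 0"
      using integral_nonneg_eq_0_iff_AE[OF h] nn c by simp
    then have "(LINT \<omega>|M. h \<omega> * indicator B (Z \<omega>)) = (LINT \<omega>|M. 0)"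
      by (intro integral_cong_AE) auto
    then show ?thesis using True by simp
  next
    case False
    have "c > 0" using False c Bochner_Integration.integral_nonneg[of M h] nn by (simp add: order.strict_iff_order)
    define Q where "Q = density M (\<lambda>\<omega>. ennreal (h \<omega> / c))"
    have [measurable]: "Z \<in> borel_measurable Q" unfolding Q_def by simp
    have hc: "integrable M (\<lambda>\<omega>. h \<omega> / c)" "(LINT \<omega>|M. h \<omega> / c) = 1"
      using h c \<open>c > 0\<close> by auto
    have "emeasure Q (space Q) = (\<integral>\<^sup>+\<omega>. ennreal (h \<omega> / c) \<partial>M)"
      unfolding Q_def by (subst emeasure_density) (auto intro!: nn_integral_cong)
    also have "\<dots> = 1"
      using nn_integral_eq_integral[OF hc(1)] hc(2) nn \<open>c > 0\<close> by simp
    finally interpret Q: prob_space Q by (rule prob_spaceI)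
    have "distr Q borel Z = std_normal_distribution"
    proof (rule Levy_uniqueness)
      show "real_distribution (distr Q borel Z)" by (rule Q.real_distribution_distr) simp
      show "char (distr Q borel Z) = char std_normal_distribution"
      proof
        fix s
        have "char (distr Q borel Z) s = (CLINT \<omega>|Q. iexp (s * Z \<omega>))"
          unfolding char_def by (subst integral_distr) auto
        also have "\<dots> = (CLINT \<omega>|M. (h \<omega> / c) *\<^sub>R iexp (s * Z \<omega>))"
          unfolding Q_def using nn \<open>c > 0\<close> by (subst integral_density) auto
        also have "\<dots> = (CLINT \<omega>|M. (h \<omega> * iexp (s * Z \<omega>)) / c)"
          by (intro Bochner_Integration.integral_cong) (auto simp: scaleR_conv_of_real)
        also have "\<dots> = exp (- s\<^sup>2 / 2)"
          using char[of s] \<open>c > 0\<close> by simp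
        finally show "char (distr Q borel Z) s = char std_normal_distribution s"
          unfolding char_std_normal_distribution .
      qed
    qed (rule real_dist_normal_dist)
    then have "measure std_normal_distribution B = measure (distr Q borel Z) B" by simp
    also have "\<dots> = (LINT x|distr Q borel Z. indicator B x)" by simp
    also have "\<dots> = (LINT \<omega>|Q. indicator B (Z \<omega>))" by (rule integral_distr) auto
    also have "\<dots> = (LINT \<omega>|M. (h \<omega> / c) *\<^sub>R indicator B (Z \<omega>))"
      unfolding Q_def using nn \<open>c > 0\<close> by (intro integral_density) auto
    also have "\<dots> = (LINT \<omega>|M. h \<omega> * indicator B (Z \<omega>)) / c" by simp
    finally show ?thesis using \<open>c > 0\<close> by simp
  qed
qed

text \<open>
  The joint characteristic function is resolved one coordinate at a time. The weights
  \<open>1 + cos (b * N)\<close> and \<open>1 + sin (b * N)\<close> are nonnegative and determine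
  \<open>E(exp(i b N) ; Z \<in> B)\<close>; with the weight \<open>indicator B (Z \<omega>)\<close> this
  in turn determines
  \<open>P(Z \<in> B, N \<in> C)\<close>.
\<close>

lemma indep_std_normal_pair:
  fixes Z N :: "'w \<Rightarrow> real"
  assumes "prob_space M"
    and Z[measurable]: "Z \<in> borel_measurable M" and N[measurable]: "N \<in> borel_measurable M"
    and char: "\<And>a b. (CLINT \<omega>|M. iexp (a * Z \<omega> + b * N \<omega>))
                 = complex_of_real (exp (- (a\<^sup>2 + b\<^sup>2) / 2))"
  shows "distr M (borel \<Otimes>\<^sub>M borel) (\<lambda>\<omega>. (Z \<omega>, N \<omega>))
           = std_normal_distribution \<Otimes>\<^sub>M std_normal_distribution"
proof -
  interpret prob_space M by fact
  interpret N1: prob_space std_normal_distribution by (rule prob_space_normal_density) simp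
  have int_iexp: "integrable M (\<lambda>\<omega>. iexp (a * Z \<omega> + b * N \<omega>))" for a b
    by (rule integrable_const_bound[where B=1]) auto
  have int_iexpZ: "integrable M (\<lambda>\<omega>. iexp (a * Z \<omega>))" for a
    using int_iexp[of a 0] by simp
  have charZ: "(CLINT \<omega>|M. iexp (a * Z \<omega>)) = complex_of_real (exp (- a\<^sup>2 / 2))" for a
    using char[of a 0] by simp
  have cosN: "(CLINT \<omega>|M. cos (b * N \<omega>) * iexp (a * Z \<omega>))
        = complex_of_real (exp (- b\<^sup>2 / 2) * exp (- a\<^sup>2 / 2))" for a b
  proof -
    have "(CLINT \<omega>|M. cos (b * N \<omega>) * iexp (a * Z \<omega>))
        = (CLINT \<omega>|M. (iexp (a * Z \<omega> + b * N \<omega>) + iexp (a * Z \<omega> + (-b) * N \<omega>)) / 2)"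
      by (intro Bochner_Integration.integral_cong refl)
         (simp add: cos_of_real[symmetric] cos_exp_eq exp_add[symmetric] field_simps exp_diff exp_minus)
    also have "\<dots> = exp (- (a\<^sup>2 + b\<^sup>2) / 2)"
      using int_iexp[of a b] int_iexp[of a "-b"] char[of a b] char[of a "-b"] by simp
    also have "exp (- (a\<^sup>2 + b\<^sup>2) / 2) = exp (- b\<^sup>2 / 2) * exp (- a\<^sup>2 / 2)"
      by (simp add: mult_exp_exp field_simps)
    finally show ?thesis .
  qed
  have sinN: "(CLINT \<omega>|M. sin (b * N \<omega>) * iexp (a * Z \<omega>)) = 0" for a b
  proof -
    have "(CLINT \<omega>|M. sin (b * N \<omega>) * iexp (a * Z \<omega>))
        = (CLINT \<omega>|M. (iexp (a * Z \<omega> + b * N \<omega>) - iexp (a * Z \<omega> + (-b) * N \<omega>)) / (2 * \<i>))"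
      by (intro Bochner_Integration.integral_cong refl)
         (simp add: sin_of_real[symmetric] sin_exp_eq exp_add[symmetric] field_simps exp_diff exp_minus)
    also have "\<dots> = 0"
      using int_iexp[of a b] int_iexp[of a "-b"] char[of a b] char[of a "-b"] by simp
    finally show ?thesis .
  qed
  have int_trig: "integrable M (\<lambda>\<omega>. complex_of_real (cos (b * N \<omega>)) * iexp (a * Z \<omega>))"
     "integrable M (\<lambda>\<omega>. complex_of_real (sin (b * N \<omega>)) * iexp (a * Z \<omega>))" for a b
    by (rule integrable_const_bound[where B=1]; simp add: norm_mult)+
  have cosB: "(LINT \<omega>|M. cos (b * N \<omega>) * indicator B (Z \<omega>))
      = exp (- b\<^sup>2 / 2) * measure std_normal_distribution B"
    and sinB: "(LINT \<omega>|M. sin (b * N \<omega>) * indicator B (Z \<omega>)) = 0"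
    if [measurable]: "B \<in> sets borel" for b and B :: "real set"
  proof -
    have int1: "integrable M (\<lambda>\<omega>. indicat_real B (Z \<omega>))"
      and intc: "integrable M (\<lambda>\<omega>. cos (b * N \<omega>) * indicator B (Z \<omega>))"
      and ints: "integrable M (\<lambda>\<omega>. sin (b * N \<omega>) * indicator B (Z \<omega>))"
      by (rule integrable_const_bound[where B=1]; simp add: abs_mult indicator_def)+
    \<comment> \<open>The weights below are shifted by 1 to be nonnegative; the weight 1 itself is subtracted again.\<close>
    have one: "(LINT \<omega>|M. 1 * indicator B (Z \<omega>)) = 1 * measure std_normal_distribution B"
      by (rule std_normal_of_weighted_char) (use charZ in auto)
    have "(LINT \<omega>|M. (1 + cos (b * N \<omega>)) * indicator B (Z \<omega>))
        = (1 + exp (- b\<^sup>2 / 2)) * measure std_normal_distribution B"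
    proof (rule std_normal_of_weighted_char)
      show "integrable M (\<lambda>\<omega>. 1 + cos (b * N \<omega>))"
        by (rule integrable_const_bound[where B=2]) (auto intro!: AE_I2 abs_triangle_ineq[THEN order_trans])
      show "1 + cos (b * N \<omega>) \<ge> 0" for \<omega> using cos_ge_minus_one[of "b * N \<omega>"] by linarith
      show "(CLINT \<omega>|M. complex_of_real (1 + cos (b * N \<omega>)) * iexp (s * Z \<omega>))
          = complex_of_real ((1 + exp (- b\<^sup>2 / 2)) * exp (- s\<^sup>2 / 2))" for s
        using int_iexpZ[of s] charZ[of s] cosN[of b s] int_trig[of b s] by (simp add: distrib_right)
    qed auto
    then show "(LINT \<omega>|M. cos (b * N \<omega>) * indicator B (Z \<omega>))
      = exp (- b\<^sup>2 / 2) * measure std_normal_distribution B"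
      using one int1 intc by (simp add: distrib_right)
    have "(LINT \<omega>|M. (1 + sin (b * N \<omega>)) * indicator B (Z \<omega>))
        = 1 * measure std_normal_distribution B"
    proof (rule std_normal_of_weighted_char)
      show "integrable M (\<lambda>\<omega>. 1 + sin (b * N \<omega>))"
        by (rule integrable_const_bound[where B=2]) (auto intro!: AE_I2 abs_triangle_ineq[THEN order_trans])
      show "1 + sin (b * N \<omega>) \<ge> 0" for \<omega> using sin_ge_minus_one[of "b * N \<omega>"] by linarith
      show "(CLINT \<omega>|M. complex_of_real (1 + sin (b * N \<omega>)) * iexp (s * Z \<omega>))
          = complex_of_real (1 * exp (- s\<^sup>2 / 2))" for s
        using int_iexpZ[of s] charZ[of s] sinN[of b s] int_trig[of b s] by (simp add: distrib_right)
    qed auto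
    then show "(LINT \<omega>|M. sin (b * N \<omega>) * indicator B (Z \<omega>)) = 0"
      using one int1 ints by (simp add: distrib_right)
  qed
  have joint: "(LINT \<omega>|M. indicat_real B (Z \<omega>) * indicator C (N \<omega>))
      = measure std_normal_distribution B * measure std_normal_distribution C"
    if [measurable]: "B \<in> sets borel" "C \<in> sets borel" for B C
  proof (rule std_normal_of_weighted_char)
    show "integrable M (\<lambda>\<omega>. indicat_real B (Z \<omega>))"
      by (rule integrable_const_bound[where B=1]) (auto simp: indicator_def)
    fix s
    have intc: "integrable M (\<lambda>\<omega>. complex_of_real (cos (s * N \<omega>) * indicator B (Z \<omega>)))"
      and ints: "integrable M (\<lambda>\<omega>. complex_of_real (sin (s * N \<omega>) * indicator B (Z \<omega>)))"
      by (rule integrable_const_bound[where B=1]; simp add: norm_mult indicator_def)+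
    have "(CLINT \<omega>|M. complex_of_real (indicator B (Z \<omega>)) * iexp (s * N \<omega>))
       = (CLINT \<omega>|M. complex_of_real (cos (s * N \<omega>) * indicator B (Z \<omega>))
            + \<i> * complex_of_real (sin (s * N \<omega>) * indicator B (Z \<omega>)))"
      by (intro Bochner_Integration.integral_cong refl) (simp add: complex_eq_iff Re_exp Im_exp)
    also have "\<dots> = complex_of_real (LINT \<omega>|M. cos (s * N \<omega>) * indicator B (Z \<omega>))
       + \<i> * complex_of_real (LINT \<omega>|M. sin (s * N \<omega>) * indicator B (Z \<omega>))"
      using intc ints by (simp only: integral_complex_of_real Bochner_Integration.integral_add
          integrable_mult_right integral_mult_right_zero)
    also have "\<dots> = complex_of_real (measure std_normal_distribution B * exp (- s\<^sup>2 / 2))"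
      using cosB[of B s] sinB[of B s] by simp
    finally show "(CLINT \<omega>|M. complex_of_real (indicator B (Z \<omega>)) * iexp (s * N \<omega>))
       = complex_of_real (measure std_normal_distribution B * exp (- s\<^sup>2 / 2))" .
  qed auto
  have "std_normal_distribution \<Otimes>\<^sub>M std_normal_distribution
      = distr M (borel \<Otimes>\<^sub>M borel) (\<lambda>\<omega>. (Z \<omega>, N \<omega>))"
  proof (rule pair_measure_eqI)
    show "sets (std_normal_distribution \<Otimes>\<^sub>M std_normal_distribution)
        = sets (distr M (borel \<Otimes>\<^sub>M borel) (\<lambda>\<omega>. (Z \<omega>, N \<omega>)))"
      unfolding sets_distr by (intro sets_pair_measure_cong) auto
    fix B C assume "B \<in> sets std_normal_distribution" "C \<in> sets std_normal_distribution"
    then have [measurable]: "B \<in> sets borel" "C \<in> sets borel" by auto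
    define A where "A = {\<omega> \<in> space M. Z \<omega> \<in> B \<and> N \<omega> \<in> C}"
    have [measurable]: "A \<in> sets M" unfolding A_def by measurable
    have "measure M A = (LINT \<omega>|M. indicator A \<omega>)" by simp
    also have "\<dots> = (LINT \<omega>|M. indicat_real B (Z \<omega>) * indicator C (N \<omega>))"
      by (intro Bochner_Integration.integral_cong refl) (auto simp: A_def indicator_def)
    finally have "measure M A = measure std_normal_distribution B * measure std_normal_distribution C"
      by (simp add: joint)
    then have "emeasure M A = emeasure std_normal_distribution B * emeasure std_normal_distribution C"
      by (simp add: emeasure_eq_measure N1.emeasure_eq_measure ennreal_mult')
    moreover have "emeasure (distr M (borel \<Otimes>\<^sub>M borel) (\<lambda>\<omega>. (Z \<omega>, N \<omega>))) (B \<times> C) = emeasure M A"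
      by (subst emeasure_distr) (auto simp: A_def intro!: arg_cong[where f="emeasure M"])
    ultimately show "emeasure std_normal_distribution B * emeasure std_normal_distribution C
        = emeasure (distr M (borel \<Otimes>\<^sub>M borel) (\<lambda>\<omega>. (Z \<omega>, N \<omega>))) (B \<times> C)" by simp
  qed (unfold_locales)
  then show ?thesis by simp
qed

section \<open>The Mehler kernel to second order in the correlation\<close>

text \<open>
  The density, relative to the product of the marginals, of a pair of standard normal variables with
  correlation \<open>r\<close>; its expansion in powers of \<open>r\<close> is Mehler's formula.
\<close>

definition mehler :: "real \<Rightarrow> real \<Rightarrow> real \<Rightarrow> real" where
  "mehler r x y = exp ((r * x * y - r\<^sup>2 * (x\<^sup>2 + y\<^sup>2) / 2) / (1 - r\<^sup>2)) / sqrt (1 - r\<^sup>2)"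

text \<open>
  If \<open>N\<close> is standard normal, then \<open>r * x + sqrt (1 - r\<^sup>2) * N\<close> is a step of the
  Ornstein-Uhlenbeck semigroup from \<open>x\<close>; the left-hand side is its density at \<open>y\<close>.
\<close>

lemma mehler_transition_density:
  assumes "\<bar>r\<bar> < 1"
  shows "std_normal_density ((y - r * x) / sqrt (1 - r\<^sup>2)) / sqrt (1 - r\<^sup>2)
           = std_normal_density y * mehler r x y"
proof -
  have r: "1 - r\<^sup>2 > 0" using assms by (simp add: abs_square_less_1)
  have "- ((y - r * x)\<^sup>2 / (1 - r\<^sup>2)) / 2
      = - y\<^sup>2 / 2 + (r * x * y - r\<^sup>2 * (x\<^sup>2 + y\<^sup>2) / 2) / (1 - r\<^sup>2)"
    using r by (simp add: field_simps power2_eq_square)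
  then show ?thesis
    using r by (simp add: std_normal_density_def mehler_def power_divide exp_add[symmetric])
qed

lemma exp_minus_linear_bound:
  fixes E :: real
  shows "\<bar>exp E - 1 - E\<bar> \<le> E\<^sup>2 / 2 * exp \<bar>E\<bar>"
proof -
  obtain t where t: "\<bar>t\<bar> \<le> \<bar>E\<bar>" "exp E = (\<Sum>m<2. E ^ m / fact m) + exp t / fact 2 * E ^ 2"
    using Maclaurin_exp_le[of E 2] by blast
  then have eq: "exp E - 1 - E = exp t * (E\<^sup>2 / 2)" by (simp add: numeral_2_eq_2)
  have "\<bar>exp E - 1 - E\<bar> = exp t * (E\<^sup>2 / 2)" unfolding eq by (simp add: abs_mult)
  also have "\<dots> \<le> exp \<bar>E\<bar> * (E\<^sup>2 / 2)" using t(1) by (intro mult_right_mono) auto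
  finally show ?thesis by (simp add: mult.commute)
qed

text \<open>
  With \<open>w = x * y\<close> and \<open>q = (x\<^sup>2 + y\<^sup>2) / 2\<close> the kernel is \<open>c * exp E\<close>, where
  \<open>c = 1 + O(r\<^sup>2)\<close>, \<open>E = r * w + O(r\<^sup>2 * q)\<close> and \<open>\<bar>E\<bar> \<le> q / 3\<close>. All errors are
  \<open>O(r\<^sup>2)\<close> times a power of \<open>q\<close> times \<open>exp (q / 3)\<close>, and \<open>exp (q / 2)\<close> absorbs
  the powers. It is important that this weight stays integrable against the Gaussian density. The
  constant is \<open>137 = 1 + 128 + 8\<close>, one summand for each of the three errors.
\<close>

lemma mehler_expansion:
  assumes r: "\<bar>r\<bar> \<le> 1 / 4"
  shows "\<bar>mehler r x y - 1 - r * x * y\<bar> \<le> 137 * r\<^sup>2 * (exp (x\<^sup>2 / 4) * exp (y\<^sup>2 / 4))"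
proof -
  define q where "q = (x\<^sup>2 + y\<^sup>2) / 2"
  define w where "w = x * y"
  define E where "E = (r * w - r\<^sup>2 * q) / (1 - r\<^sup>2)"
  define c where "c = 1 / sqrt (1 - r\<^sup>2)"
  have q0: "q \<ge> 0" unfolding q_def by simp
  have wq: "\<bar>w\<bar> \<le> q"
  proof -
    have "2 * w \<le> x\<^sup>2 + y\<^sup>2" "- 2 * w \<le> x\<^sup>2 + y\<^sup>2"
      using zero_le_power2[of "x - y"] zero_le_power2[of "x + y"]
      by (simp_all add: power2_diff power2_sum w_def)
    then show ?thesis unfolding q_def by (simp add: abs_le_iff)
  qed
  have r2: "r\<^sup>2 \<le> 1 / 16" using power_mono[OF r, of 2] by (simp add: power_divide)
  then have d: "1 - r\<^sup>2 > 0" by simp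
  have fac: "1 - r\<^sup>2 = (1 - \<bar>r\<bar>) * (1 + \<bar>r\<bar>)"
    by (simp add: algebra_simps power2_eq_square flip: abs_mult)
  have div: "(1 + \<bar>r\<bar>) / (1 - r\<^sup>2) \<le> 4 / 3"
  proof -
    have "(1 + \<bar>r\<bar>) / (1 - r\<^sup>2) = 1 / (1 - \<bar>r\<bar>)"
      unfolding fac using r by (simp add: divide_simps)
    also have "\<dots> \<le> 4 / 3" using r by (simp add: divide_simps)
    finally show ?thesis .
  qed
  have sq: "\<bar>r\<bar> * \<bar>r\<bar> = r\<^sup>2" by (simp add: power2_eq_square flip: abs_mult)
  have Eb: "\<bar>E\<bar> \<le> 4 / 3 * (\<bar>r\<bar> * q)"
  proof -
    have "\<bar>r * w - r\<^sup>2 * q\<bar> \<le> \<bar>r\<bar> * \<bar>w\<bar> + r\<^sup>2 * q"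
      using abs_triangle_ineq4[of "r * w" "r\<^sup>2 * q"] q0 by (simp add: abs_mult)
    also have "\<dots> \<le> \<bar>r\<bar> * q + r\<^sup>2 * q" using wq by (simp add: mult_left_mono)
    also have "\<dots> = (\<bar>r\<bar> * q) * (1 + \<bar>r\<bar>)" by (simp add: distrib_left mult.assoc flip: sq)
    finally have "\<bar>E\<bar> \<le> (\<bar>r\<bar> * q) * (1 + \<bar>r\<bar>) / (1 - r\<^sup>2)"
      using d unfolding E_def by (simp add: abs_divide divide_right_mono)
    also have "\<dots> = (\<bar>r\<bar> * q) * ((1 + \<bar>r\<bar>) / (1 - r\<^sup>2))" by simp
    also have "\<dots> \<le> (\<bar>r\<bar> * q) * (4 / 3)" using div q0 by (intro mult_left_mono) auto
    finally show ?thesis by simp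
  qed
  have Elin: "\<bar>E - r * w\<bar> \<le> 4 / 3 * (r\<^sup>2 * q)"
  proof -
    have "E - r * w = r\<^sup>2 * (r * w - q) / (1 - r\<^sup>2)"
      unfolding E_def using d by (simp add: field_simps power2_eq_square)
    then have "\<bar>E - r * w\<bar> = r\<^sup>2 * (\<bar>r * w - q\<bar> / (1 - r\<^sup>2))" using d by (simp add: abs_mult)
    also have "\<bar>r * w - q\<bar> \<le> \<bar>r\<bar> * \<bar>w\<bar> + q"
      using abs_triangle_ineq4[of "r * w" q] q0 by (simp add: abs_mult)
    also have "\<bar>r\<bar> * \<bar>w\<bar> + q \<le> \<bar>r\<bar> * q + q" using wq by (simp add: mult_left_mono)
    also have "\<dots> = q * (1 + \<bar>r\<bar>)" by (simp add: algebra_simps)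
    finally have "\<bar>E - r * w\<bar> \<le> r\<^sup>2 * (q * (1 + \<bar>r\<bar>) / (1 - r\<^sup>2))"
      using d by (simp add: mult_left_mono divide_right_mono)
    also have "\<dots> = (r\<^sup>2 * q) * ((1 + \<bar>r\<bar>) / (1 - r\<^sup>2))" by simp
    also have "\<dots> \<le> (r\<^sup>2 * q) * (4 / 3)" using div q0 by (intro mult_left_mono) auto
    finally show ?thesis by simp
  qed
  have Eq: "\<bar>E\<bar> \<le> q / 3"
    using Eb mult_right_mono[OF r q0] by simp
  have E2: "E\<^sup>2 \<le> 16 / 9 * (r\<^sup>2 * q\<^sup>2)"
    using power_mono[OF Eb abs_ge_zero, of 2] by (simp add: power_mult_distrib power_divide)
  have cb: "0 \<le> c - 1" "c - 1 \<le> r\<^sup>2"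
  proof -
    have "sqrt (1 - r\<^sup>2) \<le> 1" "0 < sqrt (1 - r\<^sup>2)" using d by auto
    then show "0 \<le> c - 1" unfolding c_def by (simp add: divide_simps)
    have "r\<^sup>2 * (r\<^sup>2 + (r\<^sup>2)\<^sup>2) \<le> r\<^sup>2 * 1"
    proof (rule mult_left_mono)
      have "(r\<^sup>2)\<^sup>2 \<le> (1 / 16)\<^sup>2" using r2 by (intro power_mono) auto
      also have "(1 / 16 :: real)\<^sup>2 \<le> 1 / 16" by (simp add: power_divide)
      finally show "r\<^sup>2 + (r\<^sup>2)\<^sup>2 \<le> 1" using r2 by linarith
    qed simp
    then have "1 \<le> (1 + r\<^sup>2)\<^sup>2 * (1 - r\<^sup>2)" by (simp add: algebra_simps power2_eq_square)
    then have "sqrt 1 \<le> sqrt ((1 + r\<^sup>2)\<^sup>2 * (1 - r\<^sup>2))" by (rule real_sqrt_le_mono)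
    then have "1 \<le> (1 + r\<^sup>2) * sqrt (1 - r\<^sup>2)" by (simp add: real_sqrt_mult)
    then show "c - 1 \<le> r\<^sup>2" unfolding c_def using d by (simp add: divide_simps distrib_right)
  qed
  have e3: "exp \<bar>E\<bar> \<le> exp (q / 3)" using Eq by simp
  have qexp: "q / 6 \<le> exp (q / 6)" "(q / 12)\<^sup>2 \<le> exp (q / 6)"
  proof -
    show "q / 6 \<le> exp (q / 6)" using exp_ge_add_one_self[of "q / 6"] by linarith
    have "(q / 12)\<^sup>2 \<le> (exp (q / 12))\<^sup>2"
      using exp_ge_add_one_self[of "q / 12"] q0 by (intro power_mono) linarith+
    also have "\<dots> = exp (q / 6)" by (simp add: power2_eq_square mult_exp_exp)
    finally show "(q / 12)\<^sup>2 \<le> exp (q / 6)" .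
  qed
  have t1: "(c - 1) * exp E \<le> r\<^sup>2 * exp (q / 2)"
    using cb Eq q0 by (intro mult_mono) auto
  have t2: "E\<^sup>2 / 2 * exp \<bar>E\<bar> \<le> 128 * r\<^sup>2 * exp (q / 2)"
  proof -
    have "E\<^sup>2 / 2 * exp \<bar>E\<bar> \<le> (8 / 9 * (r\<^sup>2 * q\<^sup>2)) * exp (q / 3)"
      using E2 e3 by (intro mult_mono) auto
    also have "q\<^sup>2 \<le> 144 * exp (q / 6)" using qexp(2) by (simp add: power_divide)
    then have "(8 / 9 * (r\<^sup>2 * q\<^sup>2)) * exp (q / 3) \<le> (8 / 9 * (r\<^sup>2 * (144 * exp (q / 6)))) * exp (q / 3)"
      by (intro mult_right_mono mult_left_mono) auto
    also have "\<dots> = 128 * r\<^sup>2 * (exp (q / 6) * exp (q / 3))" by simp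
    also have "exp (q / 6) * exp (q / 3) = exp (q / 2)" by (simp add: mult_exp_exp)
    finally show ?thesis .
  qed
  have t3: "4 / 3 * (r\<^sup>2 * q) \<le> 8 * r\<^sup>2 * exp (q / 2)"
  proof -
    have "q \<le> 6 * exp (q / 6)" using qexp(1) by simp
    also have "\<dots> \<le> 6 * exp (q / 2)" using q0 by simp
    finally have "r\<^sup>2 * q \<le> r\<^sup>2 * (6 * exp (q / 2))" by (rule mult_left_mono) simp
    then show ?thesis by (simp add: mult_ac)
  qed
  \<comment> \<open>The three summands on the right are the errors bounded in \<open>t1\<close>, \<open>t2\<close> and \<open>t3\<close>.\<close>
  have "mehler r x y = c * exp E"
    unfolding mehler_def c_def E_def q_def w_def by (simp add: mult.assoc)
  then have "mehler r x y - 1 - r * x * y = (c - 1) * exp E + (exp E - 1 - E) + (E - r * w)"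
    unfolding w_def by (simp add: algebra_simps)
  also have "\<bar>\<dots>\<bar> \<le> (c - 1) * exp E + \<bar>exp E - 1 - E\<bar> + \<bar>E - r * w\<bar>"
  proof -
    have "(c - 1) * exp E \<ge> 0" using cb by simp
    then show ?thesis by linarith
  qed
  also have "\<dots> \<le> 137 * r\<^sup>2 * exp (q / 2)"
    using t1 t2 t3 exp_minus_linear_bound[of E] Elin by linarith
  also have "exp (q / 2) = exp (x\<^sup>2 / 4) * exp (y\<^sup>2 / 4)"
    by (simp add: q_def mult_exp_exp add_divide_distrib)
  finally show ?thesis .
qed

section \<open>Covariances of functions of Hermite rank two\<close>

text \<open>
  \<open>exp (x\<^sup>2 / 4) * std_normal_density x\<close> is \<open>sqrt 2\<close> times the density of the normal law
  with variance 2, so both summands are moments of that law. The factor \<open>(3 + x\<^sup>2) / 2\<close>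
  stands in for \<open>1 + \<bar>x\<bar>\<close>, which it dominates.
\<close>

lemma has_integral_quadratic_gauss:
  "has_bochner_integral lborel
     (\<lambda>x. (3 + x\<^sup>2) / 2 * (exp (x\<^sup>2 / 4) * std_normal_density x)) (5 / 2 * sqrt 2)"
proof -
  have "has_bochner_integral lborel (\<lambda>x. 3 / 2 * (sqrt 2 * (normal_density 0 (sqrt 2) x * (x - 0) ^ (2 * 0)))
          + 1 / 2 * (sqrt 2 * (normal_density 0 (sqrt 2) x * (x - 0) ^ (2 * 1))))
       (3 / 2 * (sqrt 2 * (fact (2 * 0) / ((2 / (sqrt 2)\<^sup>2) ^ 0 * fact 0)))
          + 1 / 2 * (sqrt 2 * (fact (2 * 1) / ((2 / (sqrt 2)\<^sup>2) ^ 1 * fact 1))))"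
    by (intro has_bochner_integral_add has_bochner_integral_mult_right normal_moment_even) auto
  moreover have "sqrt 2 * normal_density 0 (sqrt 2) x = exp (x\<^sup>2 / 4) * std_normal_density x" for x :: real
  proof -
    have "exp (x\<^sup>2 / 4) * exp (- (x\<^sup>2) / 2) = exp (- (x\<^sup>2) / 4)" by (simp add: mult_exp_exp)
    then show ?thesis
      by (simp add: normal_density_def real_sqrt_mult field_simps)
  qed
  then have "3 / 2 * (sqrt 2 * (normal_density 0 (sqrt 2) x * (x - 0) ^ (2 * 0)))
          + 1 / 2 * (sqrt 2 * (normal_density 0 (sqrt 2) x * (x - 0) ^ (2 * 1)))
      = (3 + x\<^sup>2) / 2 * (exp (x\<^sup>2 / 4) * std_normal_density x)" for x :: real
    by (simp add: algebra_simps add_divide_distrib power2_eq_square)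
  moreover have "3 / 2 * (sqrt 2 * (fact (2 * 0) / ((2 / (sqrt 2)\<^sup>2) ^ 0 * fact 0)))
          + 1 / 2 * (sqrt 2 * (fact (2 * 1) / ((2 / (sqrt 2)\<^sup>2) ^ 1 * fact 1))) = 5 / 2 * sqrt 2"
    by simp
  ultimately show ?thesis by (simp only:)
qed

lemma one_plus_abs_le: "1 + \<bar>x\<bar> \<le> (3 + x\<^sup>2) / (2::real)"
proof -
  have "0 \<le> (1 - \<bar>x\<bar>)\<^sup>2" by simp
  then show ?thesis by (simp add: power2_diff)
qed

text \<open>
  The semigroup damps a function of Hermite rank two by a factor \<open>r\<^sup>2\<close>: since \<open>G\<close> is
  orthogonal to 1 and to the identity, \<open>1 + r * x * y\<close> may be subtracted from the kernel.
\<close>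

lemma ornstein_uhlenbeck_rank_two:
  fixes G :: "real \<Rightarrow> real"
  assumes r: "\<bar>r\<bar> \<le> 1 / 4" and G[measurable]: "G \<in> borel_measurable borel"
    and growth: "\<And>y. \<bar>G y\<bar> \<le> 1 + \<bar>y\<bar>"
    and orth0: "(LINT y|std_normal_distribution. G y) = 0"
    and orth1: "(LINT y|std_normal_distribution. y * G y) = 0"
  shows "\<bar>LINT z|std_normal_distribution. G (r * x + sqrt (1 - r\<^sup>2) * z)\<bar>
           \<le> 137 * r\<^sup>2 * exp (x\<^sup>2 / 4) * (5 / 2 * sqrt 2)"
proof -
  define s where "s = sqrt (1 - r\<^sup>2)"
  have r1: "\<bar>r\<bar> < 1" using r by simp
  then have "1 - r\<^sup>2 > 0" by (simp add: abs_square_less_1)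
  then have s: "s > 0" unfolding s_def by simp
  let ?n = std_normal_density
  have bnd: "integrable lborel (\<lambda>y. (3 + y\<^sup>2) / 2 * (exp (y\<^sup>2 / 4) * ?n y))"
    and bndI: "(LINT y|lborel. (3 + y\<^sup>2) / 2 * (exp (y\<^sup>2 / 4) * ?n y)) = 5 / 2 * sqrt 2"
    using has_integral_quadratic_gauss by (auto simp: has_bochner_integral_iff)
  have g: "\<bar>G y\<bar> \<le> (3 + y\<^sup>2) / 2" for y using growth[of y] one_plus_abs_le[of y] by linarith
  have i0: "integrable lborel (\<lambda>y. ?n y * G y)"
  proof (rule Bochner_Integration.integrable_bound[OF bnd], measurable, intro AE_I2)
    fix y
    have "\<bar>?n y * G y\<bar> \<le> ?n y * ((3 + y\<^sup>2) / 2)" using mult_left_mono[OF g[of y], of "?n y"] by (simp only: abs_mult) simp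
    also have "\<dots> \<le> ?n y * ((3 + y\<^sup>2) / 2 * exp (y\<^sup>2 / 4))"
      using mult_left_mono[of 1 "exp (y\<^sup>2 / 4)" "(3 + y\<^sup>2) / 2"] by (intro mult_left_mono) auto
    finally show "norm (?n y * G y) \<le> norm ((3 + y\<^sup>2) / 2 * (exp (y\<^sup>2 / 4) * ?n y))"
      by (simp add: abs_mult mult_ac)
  qed
  have i1: "integrable lborel (\<lambda>y. ?n y * (y * G y))"
  proof (rule Bochner_Integration.integrable_bound[where f="\<lambda>y. 2 * (?n y * \<bar>y\<bar> ^ 0) + 2 * (?n y * \<bar>y\<bar> ^ 2)"])
    show "integrable lborel (\<lambda>y. 2 * (?n y * \<bar>y\<bar> ^ 0) + 2 * (?n y * \<bar>y\<bar> ^ 2))"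
      by (intro Bochner_Integration.integrable_add integrable_mult_right integrable_std_normal_moment_abs)
    show "AE y in lborel. norm (?n y * (y * G y)) \<le> norm (2 * (?n y * \<bar>y\<bar> ^ 0) + 2 * (?n y * \<bar>y\<bar> ^ 2))"
    proof (intro AE_I2)
      fix y :: real
      have "\<bar>y\<bar> * \<bar>G y\<bar> \<le> \<bar>y\<bar> * (1 + \<bar>y\<bar>)" by (intro mult_left_mono growth) simp
      also have "\<dots> \<le> 2 + 2 * \<bar>y\<bar> ^ 2"
      proof -
        have "\<bar>y\<bar> * (1 + \<bar>y\<bar>) = \<bar>y\<bar> + \<bar>y\<bar> ^ 2" by (simp add: distrib_left power2_eq_square)
        moreover have "(1 - \<bar>y\<bar>)\<^sup>2 = 1 - 2 * \<bar>y\<bar> + \<bar>y\<bar> ^ 2" by (simp add: power2_diff)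
        ultimately show ?thesis using zero_le_power2[of "1 - \<bar>y\<bar>"] zero_le_power2[of "\<bar>y\<bar>"] by linarith
      qed
      finally have "?n y * (\<bar>y\<bar> * \<bar>G y\<bar>) \<le> ?n y * (2 + 2 * \<bar>y\<bar> ^ 2)" by (intro mult_left_mono) auto
      moreover have "norm (?n y * (y * G y)) = ?n y * (\<bar>y\<bar> * \<bar>G y\<bar>)"
        by (simp add: abs_mult)
      moreover have "?n y * (2 + 2 * \<bar>y\<bar> ^ 2) = 2 * (?n y * \<bar>y\<bar> ^ 0) + 2 * (?n y * \<bar>y\<bar> ^ 2)"
        by (simp add: distrib_left)
      ultimately show "norm (?n y * (y * G y)) \<le> norm (2 * (?n y * \<bar>y\<bar> ^ 0) + 2 * (?n y * \<bar>y\<bar> ^ 2))"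
        unfolding real_norm_def by linarith
    qed
  qed measurable
  have o0: "(LINT y|lborel. ?n y * G y) = 0"
    using orth0 by (subst (asm) integral_density) auto
  have o1: "(LINT y|lborel. ?n y * (y * G y)) = 0"
    using orth1 by (subst (asm) integral_density) auto
  have rem: "\<bar>?n y * (mehler r x y - 1 - r * x * y) * G y\<bar>
      \<le> 137 * r\<^sup>2 * exp (x\<^sup>2 / 4) * ((3 + y\<^sup>2) / 2 * (exp (y\<^sup>2 / 4) * ?n y))" for y
  proof -
    have "\<bar>?n y * (mehler r x y - 1 - r * x * y) * G y\<bar>
        = ?n y * (\<bar>mehler r x y - 1 - r * x * y\<bar> * \<bar>G y\<bar>)" by (simp add: abs_mult)
    also have "\<dots> \<le> ?n y * (137 * r\<^sup>2 * (exp (x\<^sup>2 / 4) * exp (y\<^sup>2 / 4)) * ((3 + y\<^sup>2) / 2))"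
      using mehler_expansion[OF r, of x y] g[of y] by (intro mult_left_mono mult_mono) auto
    finally show ?thesis by (simp add: mult_ac)
  qed
  have [measurable]: "(\<lambda>y. mehler r x y) \<in> borel_measurable borel" unfolding mehler_def by measurable
  have irem: "integrable lborel (\<lambda>y. ?n y * (mehler r x y - 1 - r * x * y) * G y)"
  proof (rule Bochner_Integration.integrable_bound[OF integrable_mult_right[OF bnd, of "137 * r\<^sup>2 * exp (x\<^sup>2 / 4)"]])
    show "AE y in lborel. norm (?n y * (mehler r x y - 1 - r * x * y) * G y)
        \<le> norm (137 * r\<^sup>2 * exp (x\<^sup>2 / 4) * ((3 + y\<^sup>2) / 2 * (exp (y\<^sup>2 / 4) * ?n y)))"
      using rem by (intro AE_I2) (simp add: abs_mult)
  qed measurable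
  have "(LINT z|std_normal_distribution. G (r * x + s * z))
      = (LINT z|lborel. ?n z * G (r * x + s * z))"
    by (subst integral_density) auto
  also have "\<dots> = (LINT y|lborel. ?n ((y - r * x) / s) / s * G y)"
    using s lborel_integral_real_affine[of s "\<lambda>y. ?n ((y - r * x) / s) / s * G y" "r * x"]
    by simp
  also have "\<dots> = (LINT y|lborel. ?n y * (mehler r x y - 1 - r * x * y) * G y
                     + (?n y * G y + r * x * (?n y * (y * G y))))"
    unfolding s_def mehler_transition_density[OF r1]
    by (intro Bochner_Integration.integral_cong) (simp_all add: algebra_simps)
  also have "\<dots> = (LINT y|lborel. ?n y * (mehler r x y - 1 - r * x * y) * G y)"
    using irem i0 i1 o0 o1 by simp
  finally have eq: "(LINT z|std_normal_distribution. G (r * x + s * z))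
      = (LINT y|lborel. ?n y * (mehler r x y - 1 - r * x * y) * G y)" .
  have "\<bar>LINT y|lborel. ?n y * (mehler r x y - 1 - r * x * y) * G y\<bar>
      \<le> (LINT y|lborel. \<bar>?n y * (mehler r x y - 1 - r * x * y) * G y\<bar>)"
    by (rule integral_abs_bound)
  also have "\<dots> \<le> (LINT y|lborel. 137 * r\<^sup>2 * exp (x\<^sup>2 / 4) * ((3 + y\<^sup>2) / 2 * (exp (y\<^sup>2 / 4) * ?n y)))"
    by (rule integral_mono[OF integrable_abs[OF irem] integrable_mult_right[OF bnd] rem])
  also have "\<dots> = 137 * r\<^sup>2 * exp (x\<^sup>2 / 4) * (5 / 2 * sqrt 2)"
    using bndI by simp
  finally show ?thesis unfolding eq[symmetric] s_def .
qed

text \<open>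
  For \<open>\<bar>r\<bar> > 1/4\<close> the left-hand side is at most 4, which is less than
  \<open>2000 * r\<^sup>2\<close>. For \<open>\<bar>r\<bar> \<le> 1/4\<close>, write \<open>Z'\<close> as
  \<open>r * Z + sqrt (1 - r\<^sup>2) * N\<close> with \<open>N\<close> independent of \<open>Z\<close>; integrating \<open>N\<close> out first
  gives the Ornstein-Uhlenbeck semigroup applied to \<open>G'\<close>. The constant comes from
  \<open>137 * (5/2 * sqrt 2)\<^sup>2 \<le> 2000\<close>.
\<close>

lemma rank_two_covariance_bound:
  fixes Z Z' :: "'w \<Rightarrow> real" and G G' :: "real \<Rightarrow> real"
  assumes "prob_space M"
    and Z[measurable]: "Z \<in> borel_measurable M" and Z'[measurable]: "Z' \<in> borel_measurable M"
    and var: "integrable M (\<lambda>\<omega>. (Z \<omega>)\<^sup>2)" "(LINT \<omega>|M. (Z \<omega>)\<^sup>2) = 1"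
    and var': "integrable M (\<lambda>\<omega>. (Z' \<omega>)\<^sup>2)" "(LINT \<omega>|M. (Z' \<omega>)\<^sup>2) = 1"
    and char: "\<And>a b. (CLINT \<omega>|M. iexp (a * Z \<omega> + b * Z' \<omega>))
                 = complex_of_real (exp (- (a\<^sup>2 + 2 * r * a * b + b\<^sup>2) / 2))"
    and G[measurable]: "G \<in> borel_measurable borel" and G'[measurable]: "G' \<in> borel_measurable borel"
    and growth: "\<And>y. \<bar>G y\<bar> \<le> 1 + \<bar>y\<bar>" "\<And>y. \<bar>G' y\<bar> \<le> 1 + \<bar>y\<bar>"
    and orth0: "(LINT y|std_normal_distribution. G' y) = 0"
    and orth1: "(LINT y|std_normal_distribution. y * G' y) = 0"
  shows "\<bar>LINT \<omega>|M. G (Z \<omega>) * G' (Z' \<omega>)\<bar> \<le> 2000 * r\<^sup>2"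
proof -
  interpret prob_space M by fact
  interpret N1: prob_space std_normal_distribution by (rule prob_space_normal_density) simp
  interpret PP: pair_sigma_finite std_normal_distribution std_normal_distribution ..
  have dom: "\<bar>G x * G' y\<bar> \<le> 2 + x\<^sup>2 + y\<^sup>2" for x y
  proof -
    have sq: "(1 + \<bar>t\<bar>)\<^sup>2 \<le> 2 + 2 * t\<^sup>2" for t :: real
      using zero_le_power2[of "1 - \<bar>t\<bar>"] by (simp add: power2_diff power2_sum)
    have "2 * (\<bar>G x\<bar> * \<bar>G' y\<bar>) \<le> \<bar>G x\<bar>\<^sup>2 + \<bar>G' y\<bar>\<^sup>2"
      using zero_le_power2[of "\<bar>G x\<bar> - \<bar>G' y\<bar>"] unfolding power2_diff by linarith
    also have "\<dots> \<le> (1 + \<bar>x\<bar>)\<^sup>2 + (1 + \<bar>y\<bar>)\<^sup>2"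
      by (intro add_mono power_mono growth) auto
    also have "\<dots> \<le> 2 * (2 + x\<^sup>2 + y\<^sup>2)" using sq[of x] sq[of y] by simp
    finally show ?thesis by (simp add: abs_mult)
  qed
  have intdom: "integrable M (\<lambda>\<omega>. 2 + (Z \<omega>)\<^sup>2 + (Z' \<omega>)\<^sup>2)" using var var' by auto
  have int: "integrable M (\<lambda>\<omega>. G (Z \<omega>) * G' (Z' \<omega>))"
    by (rule Bochner_Integration.integrable_bound[OF intdom])
       (use dom in \<open>auto intro!: AE_I2 order_trans[OF dom]\<close>)
  show ?thesis
  proof (cases "\<bar>r\<bar> \<le> 1 / 4")
    case False
    have "\<bar>LINT \<omega>|M. G (Z \<omega>) * G' (Z' \<omega>)\<bar> \<le> (LINT \<omega>|M. \<bar>G (Z \<omega>) * G' (Z' \<omega>)\<bar>)"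
      by (rule integral_abs_bound)
    also have "\<dots> \<le> (LINT \<omega>|M. 2 + (Z \<omega>)\<^sup>2 + (Z' \<omega>)\<^sup>2)"
      using int intdom dom by (intro integral_mono) auto
    also have "\<dots> = 4" using var var' by (simp add: prob_space)
    also have "\<dots> \<le> 2000 * (1 / 4)\<^sup>2" by (simp add: power_divide)
    also have "\<dots> \<le> 2000 * \<bar>r\<bar>\<^sup>2" using False by (intro mult_left_mono power_mono) auto
    finally show ?thesis by simp
  next
    case True
    define s where "s = sqrt (1 - r\<^sup>2)"
    have "1 - r\<^sup>2 > 0" using True by (simp add: abs_square_less_1)
    then have s: "s > 0" "s\<^sup>2 = 1 - r\<^sup>2" unfolding s_def by auto
    define N where "N = (\<lambda>\<omega>. (Z' \<omega> - r * Z \<omega>) / s)"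
    have N[measurable]: "N \<in> borel_measurable M" unfolding N_def by measurable
    have Z'_eq: "Z' \<omega> = r * Z \<omega> + s * N \<omega>" for \<omega> unfolding N_def using s by simp
    have law: "distr M (borel \<Otimes>\<^sub>M borel) (\<lambda>\<omega>. (Z \<omega>, N \<omega>))
        = std_normal_distribution \<Otimes>\<^sub>M std_normal_distribution"
    proof (rule indep_std_normal_pair)
      fix a b
      have quad: "(a - b * r / s)\<^sup>2 + 2 * r * (a - b * r / s) * (b / s) + (b / s)\<^sup>2 = a\<^sup>2 + b\<^sup>2"
      proof -
        have "(a - b * r / s)\<^sup>2 + 2 * r * (a - b * r / s) * (b / s) + (b / s)\<^sup>2
            = a\<^sup>2 + b\<^sup>2 * (1 - r\<^sup>2) / s\<^sup>2"
          using s(1) by (simp add: field_simps power2_eq_square)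
        also have "\<dots> = a\<^sup>2 + b\<^sup>2" using s(1) by (simp flip: s(2))
        finally show ?thesis .
      qed
      have "(CLINT \<omega>|M. iexp (a * Z \<omega> + b * N \<omega>))
          = (CLINT \<omega>|M. iexp ((a - b * r / s) * Z \<omega> + (b / s) * Z' \<omega>))"
        unfolding N_def using s(1)
        by (intro Bochner_Integration.integral_cong refl arg_cong[where f=iexp])
           (simp add: field_simps)
      then show "(CLINT \<omega>|M. iexp (a * Z \<omega> + b * N \<omega>)) = complex_of_real (exp (- (a\<^sup>2 + b\<^sup>2) / 2))"
        unfolding char quad .
    qed (use assms(1) in auto)
    let ?F = "\<lambda>p. G (fst p) * G' (r * fst p + s * snd p)"
    have intF: "integrable (std_normal_distribution \<Otimes>\<^sub>M std_normal_distribution) ?F"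
      unfolding law[symmetric] by (subst integrable_distr_eq) (use int in \<open>auto simp: Z'_eq\<close>)
    define I where "I = (\<lambda>x. LINT z|std_normal_distribution. G' (r * x + s * z))"
    have bnd: "integrable std_normal_distribution (\<lambda>x. (3 + x\<^sup>2) / 2 * exp (x\<^sup>2 / 4))"
      and bndI: "(LINT x|std_normal_distribution. (3 + x\<^sup>2) / 2 * exp (x\<^sup>2 / 4)) = 5 / 2 * sqrt 2"
      using has_integral_quadratic_gauss
      by (auto simp: has_bochner_integral_iff integrable_density integral_density mult_ac)
    have "(LINT \<omega>|M. G (Z \<omega>) * G' (Z' \<omega>)) = (LINT \<omega>|M. ?F (Z \<omega>, N \<omega>))"
      by (simp add: Z'_eq)
    also have "\<dots> = integral\<^sup>L (std_normal_distribution \<Otimes>\<^sub>M std_normal_distribution) ?F"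
      unfolding law[symmetric] by (rule integral_distr[symmetric]) auto
    also have "\<dots> = (LINT x|std_normal_distribution. LINT z|std_normal_distribution. ?F (x, z))"
      using PP.integral_fst'[OF intF] by simp
    also have "\<dots> = (LINT x|std_normal_distribution. G x * I x)"
      unfolding I_def by simp
    finally have eq: "(LINT \<omega>|M. G (Z \<omega>) * G' (Z' \<omega>)) = (LINT x|std_normal_distribution. G x * I x)" .
    have "\<bar>G x * I x\<bar> \<le> 137 * r\<^sup>2 * (5 / 2 * sqrt 2) * ((3 + x\<^sup>2) / 2 * exp (x\<^sup>2 / 4))" for x
    proof -
      have "\<bar>I x\<bar> \<le> 137 * r\<^sup>2 * exp (x\<^sup>2 / 4) * (5 / 2 * sqrt 2)"
        unfolding I_def s_def by (rule ornstein_uhlenbeck_rank_two[OF True G' growth(2) orth0 orth1])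
      then have "\<bar>G x\<bar> * \<bar>I x\<bar> \<le> ((3 + x\<^sup>2) / 2) * (137 * r\<^sup>2 * exp (x\<^sup>2 / 4) * (5 / 2 * sqrt 2))"
        using growth(1)[of x] one_plus_abs_le[of x] by (intro mult_mono) auto
      then show ?thesis by (simp add: abs_mult mult_ac)
    qed
    then have "\<And>x. x \<in> space std_normal_distribution \<Longrightarrow> \<bar>G x * I x\<bar> \<le> 137 * r\<^sup>2 * (5 / 2 * sqrt 2) * ((3 + x\<^sup>2) / 2 * exp (x\<^sup>2 / 4))"
      by blast
    then have "(LINT x|std_normal_distribution. \<bar>G x * I x\<bar>)
        \<le> (LINT x|std_normal_distribution. 137 * r\<^sup>2 * (5 / 2 * sqrt 2) * ((3 + x\<^sup>2) / 2 * exp (x\<^sup>2 / 4)))"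
      by (rule integral_mono'[OF integrable_mult_right[OF bnd]]) (simp, intro mult_nonneg_nonneg, simp_all)
    also have "\<dots> = 137 * (25 / 2) * r\<^sup>2" using bndI by simp
    also have "\<dots> \<le> 2000 * r\<^sup>2" by (intro mult_right_mono) auto
    finally show ?thesis unfolding eq
      using integral_abs_bound[of std_normal_distribution "\<lambda>x. G x * I x"] by linarith
  qed
qed

section \<open>Second moments and perturbation of characteristic functions\<close>

lemma square_integrable_mult:
  fixes f g :: "'a \<Rightarrow> real"
  assumes [measurable]: "f \<in> borel_measurable M" "g \<in> borel_measurable M"
    and f: "integrable M (\<lambda>x. (f x)\<^sup>2)" and g: "integrable M (\<lambda>x. (g x)\<^sup>2)"
  shows "integrable M (\<lambda>x. f x * g x)"
proof (rule Bochner_Integration.integrable_bound[OF Bochner_Integration.integrable_add[OF f g]])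
  show "AE x in M. norm (f x * g x) \<le> norm ((f x)\<^sup>2 + (g x)\<^sup>2)"
  proof (intro AE_I2)
    fix x
    have "2 * (\<bar>f x\<bar> * \<bar>g x\<bar>) \<le> (f x)\<^sup>2 + (g x)\<^sup>2"
      using zero_le_power2[of "\<bar>f x\<bar> - \<bar>g x\<bar>"] unfolding power2_diff power2_abs by linarith
    moreover have "0 \<le> \<bar>f x\<bar> * \<bar>g x\<bar>" by simp
    ultimately show "norm (f x * g x) \<le> norm ((f x)\<^sup>2 + (g x)\<^sup>2)"
      unfolding real_norm_def abs_mult by linarith
  qed
qed measurable

lemma square_integrable_add:
  fixes f g :: "'a \<Rightarrow> real"
  assumes [measurable]: "f \<in> borel_measurable M" "g \<in> borel_measurable M"
    and "integrable M (\<lambda>x. (f x)\<^sup>2)" "integrable M (\<lambda>x. (g x)\<^sup>2)"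
  shows "integrable M (\<lambda>x. (f x + g x)\<^sup>2)"
    and "(LINT x|M. (f x + g x)\<^sup>2)
          = (LINT x|M. (f x)\<^sup>2) + 2 * (LINT x|M. f x * g x) + (LINT x|M. (g x)\<^sup>2)"
  using square_integrable_mult[OF assms] assms(3,4)
  by (auto simp: power2_sum mult.assoc)

lemma integral_Cauchy_Schwarz:
  fixes f g :: "'a \<Rightarrow> real"
  assumes [measurable]: "f \<in> borel_measurable M" "g \<in> borel_measurable M"
    and f: "integrable M (\<lambda>x. (f x)\<^sup>2)" and g: "integrable M (\<lambda>x. (g x)\<^sup>2)"
  shows "\<bar>LINT x|M. f x * g x\<bar> \<le> sqrt (LINT x|M. (f x)\<^sup>2) * sqrt (LINT x|M. (g x)\<^sup>2)"
proof -
  define F where "F = (LINT x|M. (f x)\<^sup>2)"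
  define H where "H = (LINT x|M. (g x)\<^sup>2)"
  define P where "P = (LINT x|M. f x * g x)"
  have H0: "H \<ge> 0" unfolding H_def by (rule Bochner_Integration.integral_nonneg) simp
  have "P\<^sup>2 \<le> F * H"
  proof (cases "H = 0")
    case True
    then have "AE x in M. (g x)\<^sup>2 = 0"
      using integral_nonneg_eq_0_iff_AE[OF g] unfolding H_def by simp
    then have "P = (LINT x|M. 0)"
      unfolding P_def by (intro integral_cong_AE) auto
    then show ?thesis using True by simp
  next
    case False
    have g': "integrable M (\<lambda>x. (- (P / H) * g x)\<^sup>2)"
      unfolding power_mult_distrib by (rule integrable_mult_right[OF g])
    have "0 \<le> (LINT x|M. (f x + - (P / H) * g x)\<^sup>2)"
      by (rule Bochner_Integration.integral_nonneg) simp
    also have "\<dots> = F + 2 * (LINT x|M. f x * (- (P / H) * g x)) + (LINT x|M. (- (P / H) * g x)\<^sup>2)"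
      unfolding F_def by (rule square_integrable_add(2)[OF _ _ f g']) auto
    also have "(LINT x|M. f x * (- (P / H) * g x)) = - (P / H) * P"
      unfolding P_def integral_mult_right_zero[symmetric]
      by (intro Bochner_Integration.integral_cong) (auto simp: mult_ac)
    also have "(LINT x|M. (- (P / H) * g x)\<^sup>2) = (P / H)\<^sup>2 * H"
      unfolding power_mult_distrib[of _ "g _"] integral_mult_right_zero by (simp add: H_def)
    also have "F + 2 * (- (P / H) * P) + (P / H)\<^sup>2 * H = F - P\<^sup>2 / H"
      using False by (simp add: power2_eq_square field_simps)
    finally show ?thesis using False H0 by (simp add: field_simps)
  qed
  then have "sqrt (P\<^sup>2) \<le> sqrt (F * H)" by (rule real_sqrt_le_mono)
  then show ?thesis by (simp add: real_sqrt_mult F_def H_def P_def)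
qed

text \<open>
  The map \<open>iexp\<close> is 1-Lipschitz, and an \<open>L\<^sup>1\<close> distance under a probability measure is at
  most the \<open>L\<^sup>2\<close> distance.
\<close>

lemma char_diff_bound:
  fixes A B :: "'w \<Rightarrow> real"
  assumes "prob_space M"
    and [measurable]: "A \<in> borel_measurable M" "B \<in> borel_measurable M"
    and sq: "integrable M (\<lambda>\<omega>. (A \<omega> - B \<omega>)\<^sup>2)"
  shows "cmod ((CLINT \<omega>|M. iexp (s * A \<omega>)) - (CLINT \<omega>|M. iexp (s * B \<omega>)))
           \<le> \<bar>s\<bar> * sqrt (LINT \<omega>|M. (A \<omega> - B \<omega>)\<^sup>2)"
proof -
  interpret prob_space M by fact
  have one: "integrable M (\<lambda>\<omega>. (1::real)\<^sup>2)" by simp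
  have "integrable M (\<lambda>\<omega>. (A \<omega> - B \<omega>) * 1)"
    by (rule square_integrable_mult) (use sq in auto)
  then have int: "integrable M (\<lambda>\<omega>. \<bar>A \<omega> - B \<omega>\<bar>)" by simp
  have ie: "integrable M (\<lambda>\<omega>. iexp (s * A \<omega>))" "integrable M (\<lambda>\<omega>. iexp (s * B \<omega>))"
    by (rule integrable_const_bound[where B=1]; simp)+
  have pt: "cmod (iexp (s * a) - iexp (s * b)) \<le> \<bar>s\<bar> * \<bar>a - b\<bar>" for a b
  proof -
    have "iexp (s * a) - iexp (s * b) = iexp (s * b) * (iexp (s * (a - b)) - 1)"
      by (simp add: exp_add[symmetric] algebra_simps)
    then have "cmod (iexp (s * a) - iexp (s * b)) = cmod (iexp (s * (a - b)) - 1)"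
      by (simp add: norm_mult)
    also have "\<dots> \<le> \<bar>s * (a - b)\<bar>"
      using iexp_approx1[of "s * (a - b)" 0] by simp
    finally show ?thesis by (simp add: abs_mult)
  qed
  have "cmod ((CLINT \<omega>|M. iexp (s * A \<omega>)) - (CLINT \<omega>|M. iexp (s * B \<omega>)))
      = cmod (CLINT \<omega>|M. iexp (s * A \<omega>) - iexp (s * B \<omega>))"
    using ie by simp
  also have "\<dots> \<le> (LINT \<omega>|M. cmod (iexp (s * A \<omega>) - iexp (s * B \<omega>)))"
    by (rule integral_norm_bound)
  also have "\<dots> \<le> (LINT \<omega>|M. \<bar>s\<bar> * \<bar>A \<omega> - B \<omega>\<bar>)"
    by (rule integral_mono[OF integrable_norm[OF Bochner_Integration.integrable_diff[OF ie]]
          integrable_mult_right[OF int] pt])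
  also have "\<dots> = \<bar>s\<bar> * \<bar>LINT \<omega>|M. \<bar>A \<omega> - B \<omega>\<bar> * 1\<bar>"
    by (simp add: Bochner_Integration.integral_nonneg)
  also have "\<bar>LINT \<omega>|M. \<bar>A \<omega> - B \<omega>\<bar> * 1\<bar>
      \<le> sqrt (LINT \<omega>|M. \<bar>A \<omega> - B \<omega>\<bar>\<^sup>2) * sqrt (LINT \<omega>|M. (1::real)\<^sup>2)"
    by (rule integral_Cauchy_Schwarz) (use sq in auto)
  finally show ?thesis by (simp add: prob_space mult_left_mono)
qed

lemma L2_convergence_second_moment:
  fixes A :: "nat \<Rightarrow> 'w \<Rightarrow> real" and B :: "'w \<Rightarrow> real"
  assumes [measurable]: "\<And>n. A n \<in> borel_measurable M" "B \<in> borel_measurable M"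
    and d: "\<And>n. integrable M (\<lambda>\<omega>. (A n \<omega> - B \<omega>)\<^sup>2)" and B: "integrable M (\<lambda>\<omega>. (B \<omega>)\<^sup>2)"
    and lim: "(\<lambda>n. LINT \<omega>|M. (A n \<omega> - B \<omega>)\<^sup>2) \<longlonglongrightarrow> 0"
  shows "(\<lambda>n. LINT \<omega>|M. (A n \<omega>)\<^sup>2) \<longlonglongrightarrow> (LINT \<omega>|M. (B \<omega>)\<^sup>2)"
proof -
  let ?e = "\<lambda>n. LINT \<omega>|M. (A n \<omega> - B \<omega>)\<^sup>2"
  have eq: "(LINT \<omega>|M. (A n \<omega>)\<^sup>2)
      = ?e n + 2 * (LINT \<omega>|M. (A n \<omega> - B \<omega>) * B \<omega>) + (LINT \<omega>|M. (B \<omega>)\<^sup>2)" for n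
    using square_integrable_add(2)[OF _ _ d[of n] B] by simp
  have "(\<lambda>n. sqrt (?e n) * sqrt (LINT \<omega>|M. (B \<omega>)\<^sup>2)) \<longlonglongrightarrow> sqrt 0 * sqrt (LINT \<omega>|M. (B \<omega>)\<^sup>2)"
    by (intro tendsto_intros lim)
  then have "(\<lambda>n. sqrt (?e n) * sqrt (LINT \<omega>|M. (B \<omega>)\<^sup>2)) \<longlonglongrightarrow> 0" by simp
  then have "(\<lambda>n. LINT \<omega>|M. (A n \<omega> - B \<omega>) * B \<omega>) \<longlonglongrightarrow> 0"
    by (rule Lim_null_comparison[rotated])
       (intro always_eventually allI, unfold real_norm_def,
        rule integral_Cauchy_Schwarz[OF _ _ d B], measurable)
  from tendsto_add[OF tendsto_add[OF lim tendsto_mult_left[OF this, of 2]] tendsto_const[of "LINT \<omega>|M. (B \<omega>)\<^sup>2"]]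
  show ?thesis unfolding eq by simp
qed

section \<open>Integrals of random fields with bounded second moments\<close>

lemma integrable_pair_of_bounded_sections:
  fixes F :: "'t \<Rightarrow> 'w \<Rightarrow> real"
  assumes "finite_measure \<mu>" "prob_space M"
    and F[measurable]: "(\<lambda>(t, \<omega>). F t \<omega>) \<in> borel_measurable (\<mu> \<Otimes>\<^sub>M M)"
    and int: "\<And>t. t \<in> space \<mu> \<Longrightarrow> integrable M (F t)"
    and bound: "\<And>t. t \<in> space \<mu> \<Longrightarrow> (LINT \<omega>|M. \<bar>F t \<omega>\<bar>) \<le> C"
  shows "integrable (\<mu> \<Otimes>\<^sub>M M) (\<lambda>(t, \<omega>). F t \<omega>)"
proof -
  interpret \<mu>: finite_measure \<mu> by fact
  interpret prob_space M by fact
  interpret pair_sigma_finite \<mu> M ..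
  show ?thesis
  proof (rule Fubini_integrable)
    have [measurable]: "(\<lambda>p. F (fst p) (snd p)) \<in> borel_measurable (\<mu> \<Otimes>\<^sub>M M)"
      using F by (simp add: case_prod_unfold)
    show "integrable \<mu> (\<lambda>t. LINT \<omega>|M. norm (case (t, \<omega>) of (t, \<omega>) \<Rightarrow> F t \<omega>))"
    proof (rule \<mu>.integrable_const_bound[where B=C])
      show "AE t in \<mu>. norm (LINT \<omega>|M. norm (case (t, \<omega>) of (t, \<omega>) \<Rightarrow> F t \<omega>)) \<le> C"
        using bound by (intro AE_I2) (simp add: Bochner_Integration.integral_nonneg)
    qed measurable
    show "AE t in \<mu>. integrable M (\<lambda>\<omega>. case (t, \<omega>) of (t, \<omega>) \<Rightarrow> F t \<omega>)"
      using int by (intro AE_I2) simp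
  qed fact
qed

text \<open>
  Sample points may repeat; collecting repetitions turns a sum over a list of points into a linear
  combination over a finite set, the form in which a Gaussian field is specified.
\<close>

lemma sum_list_eq_sum_count_real:
  fixes f :: "'a \<Rightarrow> real"
  shows "(\<Sum>x\<leftarrow>xs. f x) = (\<Sum>x\<in>set xs. real (count_list xs x) * f x)"
proof (induction xs)
  case (Cons a xs)
  have "(\<Sum>x\<in>set (a # xs). real (count_list (a # xs) x) * f x)
      = (\<Sum>x\<in>set (a # xs). (if x = a then f x else 0) + real (count_list xs x) * f x)"
    by (intro sum.cong) (auto simp: algebra_simps)
  also have "\<dots> = f a + (\<Sum>x\<in>set (a # xs). real (count_list xs x) * f x)"
    by (simp add: sum.distrib del: set_simps) simp
  also have "(\<Sum>x\<in>set (a # xs). real (count_list xs x) * f x)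
      = (\<Sum>x\<in>set xs. real (count_list xs x) * f x)"
    by (intro sum.mono_neutral_right) (auto simp: count_list_0_iff)
  finally show ?case using Cons.IH by simp
qed simp

locale L2_bounded_field = prob_space M + \<mu>: finite_measure \<mu>
  for M :: "'w measure" and \<mu> :: "'t measure" +
  fixes K :: "'t \<Rightarrow> 'w \<Rightarrow> real" and C :: real
  assumes joint: "(\<lambda>(t, \<omega>). K t \<omega>) \<in> borel_measurable (\<mu> \<Otimes>\<^sub>M M)"
    and space_index: "space \<mu> = UNIV"
    and square_integrable: "\<And>t. integrable M (\<lambda>\<omega>. (K t \<omega>)\<^sup>2)"
    and second_moment_le: "\<And>t. (LINT \<omega>|M. (K t \<omega>)\<^sup>2) \<le> C"
begin

sublocale pair_sigma_finite \<mu> M ..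

definition path_integral :: "'w \<Rightarrow> real" where
  "path_integral \<omega> = (LINT t|\<mu>. K t \<omega>)"

lemma measurable_section [measurable]: "K t \<in> borel_measurable M"
  using measurable_Pair2[OF joint, of t] space_index by simp

lemma measurable_joint' [measurable]: "(\<lambda>p. K (fst p) (snd p)) \<in> borel_measurable (\<mu> \<Otimes>\<^sub>M M)"
  using joint by (simp add: case_prod_unfold)

text \<open>
  The moment bound, together with finiteness of \<open>\<mu>\<close>, is what makes Fubini's theorem applicable; the
  weight \<open>S\<close> is needed for covariances with the integral of the field.
\<close>

lemma integrable_weighted:
  assumes [measurable]: "S \<in> borel_measurable M" and S: "integrable M (\<lambda>\<omega>. (S \<omega>)\<^sup>2)"
  shows "integrable (\<mu> \<Otimes>\<^sub>M M) (\<lambda>(t, \<omega>). S \<omega> * K t \<omega>)"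
proof (rule integrable_pair_of_bounded_sections)
  show "(\<lambda>(t, \<omega>). S \<omega> * K t \<omega>) \<in> borel_measurable (\<mu> \<Otimes>\<^sub>M M)"
    unfolding case_prod_unfold by measurable
  fix t
  show i: "integrable M (\<lambda>\<omega>. S \<omega> * K t \<omega>)"
    by (rule square_integrable_mult[OF _ _ S square_integrable]) auto
  have "\<bar>S \<omega> * K t \<omega>\<bar> \<le> (S \<omega>)\<^sup>2 + (K t \<omega>)\<^sup>2" for \<omega>
  proof -
    have "2 * (\<bar>S \<omega>\<bar> * \<bar>K t \<omega>\<bar>) \<le> (S \<omega>)\<^sup>2 + (K t \<omega>)\<^sup>2"
      using zero_le_power2[of "\<bar>S \<omega>\<bar> - \<bar>K t \<omega>\<bar>"] unfolding power2_diff power2_abs by linarith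
    moreover have "0 \<le> \<bar>S \<omega>\<bar> * \<bar>K t \<omega>\<bar>" by simp
    ultimately show ?thesis unfolding abs_mult by linarith
  qed
  then have "(LINT \<omega>|M. \<bar>S \<omega> * K t \<omega>\<bar>) \<le> (LINT \<omega>|M. (S \<omega>)\<^sup>2 + (K t \<omega>)\<^sup>2)"
    by (intro integral_mono integrable_abs[OF i] Bochner_Integration.integrable_add S square_integrable)
  also have "\<dots> \<le> (LINT \<omega>|M. (S \<omega>)\<^sup>2) + C"
    using S square_integrable[of t] second_moment_le[of t] by simp
  finally show "(LINT \<omega>|M. \<bar>S \<omega> * K t \<omega>\<bar>) \<le> (LINT \<omega>|M. (S \<omega>)\<^sup>2) + C" .
qed unfold_locales

lemma integrable_joint: "integrable (\<mu> \<Otimes>\<^sub>M M) (\<lambda>(t, \<omega>). K t \<omega>)"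
  using integrable_weighted[of "\<lambda>_. 1"] by simp

lemma AE_integrable_path: "AE \<omega> in M. integrable \<mu> (\<lambda>t. K t \<omega>)"
  by (rule AE_integrable_snd[OF integrable_joint])

lemma measurable_path_integral [measurable]: "path_integral \<in> borel_measurable M"
  using integrable_snd[OF integrable_joint] unfolding path_integral_def[abs_def] by auto

lemma expectation_mult_path_integral:
  assumes [measurable]: "S \<in> borel_measurable M" and S: "integrable M (\<lambda>\<omega>. (S \<omega>)\<^sup>2)"
  shows "integrable \<mu> (\<lambda>t. LINT \<omega>|M. S \<omega> * K t \<omega>)"
    and "(LINT \<omega>|M. S \<omega> * path_integral \<omega>) = (LINT t|\<mu>. LINT \<omega>|M. S \<omega> * K t \<omega>)"
  using integrable_fst'[OF integrable_weighted[OF assms]]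
    Fubini_integral[OF integrable_weighted[OF assms]]
  by (auto simp: path_integral_def)

lemma second_moment_path_integral:
  shows square_integrable_path_integral: "integrable M (\<lambda>\<omega>. (path_integral \<omega>)\<^sup>2)"
    and "(LINT \<omega>|M. (path_integral \<omega>)\<^sup>2) = (LINT s|\<mu>. LINT t|\<mu>. LINT \<omega>|M. K t \<omega> * K s \<omega>)"
proof -
  interpret mm: pair_sigma_finite \<mu> \<mu> ..
  interpret \<nu>: finite_measure "\<mu> \<Otimes>\<^sub>M \<mu>"
    by (intro finite_measure_pair_measure \<mu>.finite_measure_axioms)
  interpret \<nu>M: pair_sigma_finite "\<mu> \<Otimes>\<^sub>M \<mu>" M ..
  let ?F = "\<lambda>p \<omega>. K (snd p) \<omega> * K (fst p) \<omega>"
  have [measurable]: "(\<lambda>p. K (f p) (g p)) \<in> borel_measurable N"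
    if "f \<in> measurable N \<mu>" "g \<in> measurable N M" for f g and N :: "'z measure"
  proof -
    have "(\<lambda>p. (f p, g p)) \<in> measurable N (\<mu> \<Otimes>\<^sub>M M)" using that by measurable
    from measurable_compose[OF this measurable_joint'] show ?thesis by simp
  qed
  have int: "integrable ((\<mu> \<Otimes>\<^sub>M \<mu>) \<Otimes>\<^sub>M M) (\<lambda>(p, \<omega>). ?F p \<omega>)"
  proof (rule integrable_pair_of_bounded_sections)
    show "(\<lambda>(p, \<omega>). ?F p \<omega>) \<in> borel_measurable ((\<mu> \<Otimes>\<^sub>M \<mu>) \<Otimes>\<^sub>M M)"
      unfolding case_prod_unfold by measurable
    fix p
    show i: "integrable M (?F p)"
      by (rule square_integrable_mult[OF _ _ square_integrable square_integrable]) auto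
    have "2 * \<bar>?F p \<omega>\<bar> \<le> (K (snd p) \<omega>)\<^sup>2 + (K (fst p) \<omega>)\<^sup>2" for \<omega>
      using zero_le_power2[of "\<bar>K (snd p) \<omega>\<bar> - \<bar>K (fst p) \<omega>\<bar>"]
      unfolding power2_diff power2_abs abs_mult by linarith
    then have "(LINT \<omega>|M. 2 * \<bar>?F p \<omega>\<bar>) \<le> (LINT \<omega>|M. (K (snd p) \<omega>)\<^sup>2 + (K (fst p) \<omega>)\<^sup>2)"
      by (intro integral_mono integrable_mult_right integrable_abs[OF i]
          Bochner_Integration.integrable_add square_integrable)
    also have "\<dots> \<le> C + C"
      using square_integrable[of "fst p"] square_integrable[of "snd p"]
        second_moment_le[of "fst p"] second_moment_le[of "snd p"] by simp
    finally show "(LINT \<omega>|M. \<bar>?F p \<omega>\<bar>) \<le> C" by simp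
  qed unfold_locales
  have path: "AE \<omega> in M. (LINT p|(\<mu> \<Otimes>\<^sub>M \<mu>). ?F p \<omega>) = (path_integral \<omega>)\<^sup>2"
    using \<nu>M.AE_integrable_snd[OF int]
  proof eventually_elim
    case (elim \<omega>)
    have "(LINT p|(\<mu> \<Otimes>\<^sub>M \<mu>). ?F p \<omega>) = (LINT s|\<mu>. LINT t|\<mu>. ?F (s, t) \<omega>)"
      using mm.integral_fst'[OF elim] by simp
    also have "\<dots> = (path_integral \<omega>)\<^sup>2"
      by (simp add: path_integral_def power2_eq_square)
    finally show ?case .
  qed
  have "integrable M (\<lambda>\<omega>. LINT p|(\<mu> \<Otimes>\<^sub>M \<mu>). ?F p \<omega>)"
    by (rule \<nu>M.integrable_snd[OF int])
  moreover from this have [measurable]: "(\<lambda>\<omega>. LINT p|(\<mu> \<Otimes>\<^sub>M \<mu>). ?F p \<omega>) \<in> borel_measurable M" by auto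
  ultimately show "integrable M (\<lambda>\<omega>. (path_integral \<omega>)\<^sup>2)"
    using path by (subst (asm) integrable_cong_AE[OF _ _ path]) auto
  have "(LINT \<omega>|M. (path_integral \<omega>)\<^sup>2) = (LINT \<omega>|M. LINT p|(\<mu> \<Otimes>\<^sub>M \<mu>). ?F p \<omega>)"
    using path by (intro integral_cong_AE) auto
  also have "\<dots> = (LINT p|(\<mu> \<Otimes>\<^sub>M \<mu>). LINT \<omega>|M. ?F p \<omega>)"
    by (rule \<nu>M.Fubini_integral[OF int])
  also have "\<dots> = (LINT s|\<mu>. LINT t|\<mu>. LINT \<omega>|M. K t \<omega> * K s \<omega>)"
    using mm.integral_fst'[OF \<nu>M.integrable_fst'[OF int]] by simp
  finally show "(LINT \<omega>|M. (path_integral \<omega>)\<^sup>2) = (LINT s|\<mu>. LINT t|\<mu>. LINT \<omega>|M. K t \<omega> * K s \<omega>)" .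
qed

text \<open>
  For \<open>m\<close> the total mass of \<open>\<mu>\<close>, the variable \<open>m * K t\<close> estimates the integral from the
  single sample point \<open>t\<close>; this bounds the error of that estimate uniformly in \<open>t\<close>.
\<close>

lemma second_moment_scaled_minus_path_integral:
  assumes m: "m = measure \<mu> (space \<mu>)"
  shows "integrable M (\<lambda>\<omega>. (m * K t \<omega> - path_integral \<omega>)\<^sup>2)"
    and "(LINT \<omega>|M. (m * K t \<omega> - path_integral \<omega>)\<^sup>2) \<le> 2 * (m\<^sup>2 * C + (LINT \<omega>|M. (path_integral \<omega>)\<^sup>2))"
proof -
  have i: "integrable M (\<lambda>\<omega>. (m * K t \<omega>)\<^sup>2)" "integrable M (\<lambda>\<omega>. (- path_integral \<omega>)\<^sup>2)"
    using square_integrable[of t] square_integrable_path_integral by (auto simp: power_mult_distrib)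
  from square_integrable_add(1)[OF _ _ this]
  show i': "integrable M (\<lambda>\<omega>. (m * K t \<omega> - path_integral \<omega>)\<^sup>2)" by simp
  have "(m * K t \<omega> - path_integral \<omega>)\<^sup>2 \<le> 2 * (m * K t \<omega>)\<^sup>2 + 2 * (- path_integral \<omega>)\<^sup>2" for \<omega>
    using zero_le_power2[of "m * K t \<omega> + path_integral \<omega>"] unfolding power2_diff power2_sum power2_minus by linarith
  then have "(LINT \<omega>|M. (m * K t \<omega> - path_integral \<omega>)\<^sup>2) \<le> (LINT \<omega>|M. 2 * (m * K t \<omega>)\<^sup>2 + 2 * (- path_integral \<omega>)\<^sup>2)"
    by (intro integral_mono i' Bochner_Integration.integrable_add integrable_mult_right i)
  also have "\<dots> = 2 * (m\<^sup>2 * (LINT \<omega>|M. (K t \<omega>)\<^sup>2)) + 2 * (LINT \<omega>|M. (path_integral \<omega>)\<^sup>2)"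
    using i by (simp add: power_mult_distrib)
  also have "\<dots> \<le> 2 * (m\<^sup>2 * C) + 2 * (LINT \<omega>|M. (path_integral \<omega>)\<^sup>2)"
    using second_moment_le[of t] by (simp add: mult_left_mono)
  finally show "(LINT \<omega>|M. (m * K t \<omega> - path_integral \<omega>)\<^sup>2) \<le> 2 * (m\<^sup>2 * C + (LINT \<omega>|M. (path_integral \<omega>)\<^sup>2))"
    by simp
qed

section \<open>Integrals of Gaussian fields are Gaussian\<close>

text \<open>
  \<open>m * K t - path_integral\<close> averages to zero over \<open>t\<close>, hence so does its covariance with
  \<open>S\<close>, which therefore cannot be positive everywhere.
\<close>

lemma exists_negatively_correlated_point:
  assumes m: "m = measure \<mu> (space \<mu>)" "m > 0"
    and [measurable]: "S \<in> borel_measurable M" and S: "integrable M (\<lambda>\<omega>. (S \<omega>)\<^sup>2)"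
  shows "\<exists>t. (LINT \<omega>|M. S \<omega> * (m * K t \<omega> - path_integral \<omega>)) \<le> 0"
proof (rule ccontr)
  define c where "c = (LINT \<omega>|M. S \<omega> * path_integral \<omega>)"
  define k where "k = (\<lambda>t. LINT \<omega>|M. S \<omega> * K t \<omega>)"
  have k: "integrable \<mu> k" "(LINT t|\<mu>. k t) = c"
    using expectation_mult_path_integral[of S] S unfolding k_def c_def by auto
  have eq: "(LINT \<omega>|M. S \<omega> * (m * K t \<omega> - path_integral \<omega>)) = m * k t - c" for t
  proof -
    have "integrable M (\<lambda>\<omega>. S \<omega> * K t \<omega>)" "integrable M (\<lambda>\<omega>. S \<omega> * path_integral \<omega>)"
      by (rule square_integrable_mult[OF _ _ S square_integrable], simp_all)
         (rule square_integrable_mult[OF _ _ S square_integrable_path_integral], simp_all)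
    then show ?thesis
      by (simp add: right_diff_distrib mult.left_commute[of _ m] k_def c_def)
  qed
  assume "\<nexists>t. (LINT \<omega>|M. S \<omega> * (m * K t \<omega> - path_integral \<omega>)) \<le> 0"
  then have pos: "m * k t - c > 0" for t unfolding eq by (simp add: not_le)
  have int: "integrable \<mu> (\<lambda>t. m * k t - c)" using k(1) by simp
  have "(LINT t|\<mu>. m * k t - c) = 0" using k m(1) by simp
  then have "AE t in \<mu>. m * k t - c = 0"
    using integral_nonneg_eq_0_iff_AE[OF int] pos by (simp add: less_imp_le)
  then have "AE t in \<mu>. False" using pos by (auto elim!: eventually_mono simp: less_le)
  then have "emeasure \<mu> (space \<mu>) = 0" by (simp add: AE_iff_null_sets null_setsD1 flip: eventually_False)
  then show False using m by (simp add: measure_def)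
qed

text \<open>
  A derandomised Monte Carlo estimate. Independent random points would make the cross terms vanish on
  average; choosing the points greedily keeps every cross term nonpositive, so the second moment of the
  accumulated error grows only linearly in the number of points.
\<close>

lemma exists_sample_points:
  assumes m: "m = measure \<mu> (space \<mu>)" "m > 0"
  shows "\<exists>ts. length ts = N \<and>
     (integrable M (\<lambda>\<omega>. (\<Sum>t\<leftarrow>ts. m * K t \<omega> - path_integral \<omega>)\<^sup>2)) \<and>
     (LINT \<omega>|M. (\<Sum>t\<leftarrow>ts. m * K t \<omega> - path_integral \<omega>)\<^sup>2)
       \<le> real N * (2 * (m\<^sup>2 * C + (LINT \<omega>|M. (path_integral \<omega>)\<^sup>2)))"
proof (induction N)
  case 0
  show ?case by (rule exI[of _ "[]"]) simp
next
  case (Suc N)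
  let ?D = "\<lambda>t \<omega>. m * K t \<omega> - path_integral \<omega>"
  let ?c = "2 * (m\<^sup>2 * C + (LINT \<omega>|M. (path_integral \<omega>)\<^sup>2))"
  obtain ts where len: "length ts = N" and int: "integrable M (\<lambda>\<omega>. (\<Sum>t\<leftarrow>ts. ?D t \<omega>)\<^sup>2)"
    and le: "(LINT \<omega>|M. (\<Sum>t\<leftarrow>ts. ?D t \<omega>)\<^sup>2) \<le> real N * ?c"
    using Suc by blast
  define S where "S = (\<lambda>\<omega>. \<Sum>t\<leftarrow>ts. ?D t \<omega>)"
  have [measurable]: "S \<in> borel_measurable M" unfolding S_def by (induction ts) simp_all
  have S: "integrable M (\<lambda>\<omega>. (S \<omega>)\<^sup>2)" and le': "(LINT \<omega>|M. (S \<omega>)\<^sup>2) \<le> real N * ?c"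
    using int le unfolding S_def .
  obtain t where t: "(LINT \<omega>|M. S \<omega> * ?D t \<omega>) \<le> 0"
    using exists_negatively_correlated_point[OF m, of S] S by auto
  note D = second_moment_scaled_minus_path_integral[OF m(1), of t]
  have ts: "(\<Sum>t\<leftarrow>t # ts. ?D t \<omega>) = S \<omega> + ?D t \<omega>" for \<omega> by (simp add: S_def)
  note sq = square_integrable_add[OF _ _ S D(1), simplified]
  have "(LINT \<omega>|M. (S \<omega> + ?D t \<omega>)\<^sup>2) \<le> real N * ?c + ?c"
    using sq(2) t D(2) le' by linarith
  also have "\<dots> = real (Suc N) * ?c" by (simp add: distrib_right)
  finally have "length (t # ts) = Suc N \<and> integrable M (\<lambda>\<omega>. (S \<omega> + ?D t \<omega>)\<^sup>2) \<and>
      (LINT \<omega>|M. (S \<omega> + ?D t \<omega>)\<^sup>2) \<le> real (Suc N) * ?c"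
    using sq(1) len by simp
  then show ?case unfolding ts[symmetric] by (rule exI)
qed

text \<open>
  Dividing the accumulated error by the number of points shows that the integral is an \<open>L\<^sup>2\<close> limit
  of finite linear combinations of the field. These are centered normal variables, and along the sequence
  both their characteristic functions and their variances converge.
\<close>

lemma gaussian_char_path_integral:
  assumes gauss: "gaussian_field M K" and centered: "\<And>t. (LINT \<omega>|M. K t \<omega>) = 0"
  shows "(CLINT \<omega>|M. iexp (s * path_integral \<omega>))
     = complex_of_real (exp (- s\<^sup>2 * (LINT \<omega>|M. (path_integral \<omega>)\<^sup>2) / 2))"
proof -
  define m where "m = measure \<mu> (space \<mu>)"
  show ?thesis
  proof (cases "m = 0")
    case True
    then have "emeasure \<mu> (space \<mu>) = 0" unfolding m_def by (simp add: \<mu>.emeasure_eq_measure)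
    then have "AE t in \<mu>. K t \<omega> = 0" for \<omega>
      by (intro AE_I[where N="space \<mu>"]) auto
    then have "path_integral \<omega> = 0" for \<omega>
      unfolding path_integral_def by (rule integral_eq_zero_AE)
    then show ?thesis by (simp add: prob_space)
  next
    case False
    then have m: "m = measure \<mu> (space \<mu>)" "m > 0"
      unfolding m_def by (auto simp: less_le)
    define c where "c = 2 * (m\<^sup>2 * C + (LINT \<omega>|M. (path_integral \<omega>)\<^sup>2))"
    have "\<forall>N. \<exists>ts. length ts = N \<and>
        integrable M (\<lambda>\<omega>. (\<Sum>t\<leftarrow>ts. m * K t \<omega> - path_integral \<omega>)\<^sup>2) \<and>
        (LINT \<omega>|M. (\<Sum>t\<leftarrow>ts. m * K t \<omega> - path_integral \<omega>)\<^sup>2) \<le> real N * c"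
      unfolding c_def by (intro allI exists_sample_points[OF m])
    from choice[OF this] obtain ts where ts: "\<And>N. length (ts N) = N"
        "\<And>N. integrable M (\<lambda>\<omega>. (\<Sum>t\<leftarrow>ts N. m * K t \<omega> - path_integral \<omega>)\<^sup>2)"
        "\<And>N. (LINT \<omega>|M. (\<Sum>t\<leftarrow>ts N. m * K t \<omega> - path_integral \<omega>)\<^sup>2) \<le> real N * c"
      by (auto simp only: all_conj_distrib)
    define L where "L = (\<lambda>N \<omega>. \<Sum>t\<in>set (ts (Suc N)).
        (m / real (Suc N) * real (count_list (ts (Suc N)) t)) * K t \<omega>)"
    have gL: "gaussian_rv M (L N)" for N
      unfolding L_def by (rule gauss[unfolded gaussian_field_def, rule_format, OF finite_set])
    have [measurable]: "L N \<in> borel_measurable M" for N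
      using gL[of N] by (simp add: gaussian_rv_def)
    have cL: "(LINT \<omega>|M. L N \<omega>) = 0" for N
    proof -
      have "integrable M (K t)" for t
        using square_integrable_mult[of "\<lambda>_. 1" M "K t"] square_integrable[of t] by simp
      then show ?thesis unfolding L_def by (simp add: centered)
    qed
    have diff: "L N \<omega> - path_integral \<omega> = (\<Sum>t\<leftarrow>ts (Suc N). m * K t \<omega> - path_integral \<omega>) / real (Suc N)" for N \<omega>
    proof -
      have "(\<Sum>t\<leftarrow>ts (Suc N). m * K t \<omega> - path_integral \<omega>)
          = (\<Sum>t\<leftarrow>ts (Suc N). m * K t \<omega>) - real (Suc N) * path_integral \<omega>"
        by (simp add: sum_list_subtractf sum_list_triv ts(1) del: of_nat_Suc)
      also have "(\<Sum>t\<leftarrow>ts (Suc N). m * K t \<omega>) = real (Suc N) * L N \<omega>"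
        unfolding sum_list_eq_sum_count_real L_def sum_distrib_left
        by (intro sum.cong refl) (simp del: of_nat_Suc)
      finally show ?thesis by (simp add: field_simps del: of_nat_Suc)
    qed
    have int: "integrable M (\<lambda>\<omega>. (L N \<omega> - path_integral \<omega>)\<^sup>2)" for N
      using ts(2)[of "Suc N"] by (simp add: diff power_divide del: of_nat_Suc)
    have le: "(LINT \<omega>|M. (L N \<omega> - path_integral \<omega>)\<^sup>2) \<le> c / real (Suc N)" for N
    proof -
      have "(LINT \<omega>|M. (L N \<omega> - path_integral \<omega>)\<^sup>2)
          = (LINT \<omega>|M. (\<Sum>t\<leftarrow>ts (Suc N). m * K t \<omega> - path_integral \<omega>)\<^sup>2) / (real (Suc N))\<^sup>2"
        by (simp add: diff power_divide del: of_nat_Suc)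
      also have "\<dots> \<le> (real (Suc N) * c) / (real (Suc N))\<^sup>2"
        by (intro divide_right_mono ts(3)) simp
      also have "\<dots> = c / real (Suc N)" by (simp add: power2_eq_square del: of_nat_Suc)
      finally show ?thesis .
    qed
    have "(\<lambda>N. c / real (Suc N)) \<longlonglongrightarrow> 0"
      using LIMSEQ_Suc[OF lim_const_over_n[of c]] by simp
    then have lim: "(\<lambda>N. LINT \<omega>|M. (L N \<omega> - path_integral \<omega>)\<^sup>2) \<longlonglongrightarrow> 0"
      by (rule Lim_null_comparison[rotated])
         (use le in \<open>auto simp: Bochner_Integration.integral_nonneg intro!: always_eventually\<close>)
    have "(\<lambda>N. \<bar>s\<bar> * sqrt (LINT \<omega>|M. (L N \<omega> - path_integral \<omega>)\<^sup>2)) \<longlonglongrightarrow> \<bar>s\<bar> * sqrt 0"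
      by (intro tendsto_intros lim)
    then have "(\<lambda>N. \<bar>s\<bar> * sqrt (LINT \<omega>|M. (L N \<omega> - path_integral \<omega>)\<^sup>2)) \<longlonglongrightarrow> 0" by simp
    then have "(\<lambda>N. (CLINT \<omega>|M. iexp (s * L N \<omega>)) - (CLINT \<omega>|M. iexp (s * path_integral \<omega>))) \<longlonglongrightarrow> 0"
      by (rule Lim_null_comparison[rotated])
         (intro always_eventually allI char_diff_bound prob_space_axioms int, measurable)
    then have lim1: "(\<lambda>N. CLINT \<omega>|M. iexp (s * L N \<omega>)) \<longlonglongrightarrow> (CLINT \<omega>|M. iexp (s * path_integral \<omega>))"
      by (rule LIM_zero_cancel)
    have "(\<lambda>N. LINT \<omega>|M. (L N \<omega>)\<^sup>2) \<longlonglongrightarrow> (LINT \<omega>|M. (path_integral \<omega>)\<^sup>2)"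
      by (rule L2_convergence_second_moment[OF _ _ int square_integrable_path_integral lim]) auto
    then have "(\<lambda>N. complex_of_real (exp (- s\<^sup>2 * (LINT \<omega>|M. (L N \<omega>)\<^sup>2) / 2)))
        \<longlonglongrightarrow> complex_of_real (exp (- s\<^sup>2 * (LINT \<omega>|M. (path_integral \<omega>)\<^sup>2) / 2))"
      by (intro tendsto_intros) auto
    then have lim2: "(\<lambda>N. CLINT \<omega>|M. iexp (s * L N \<omega>))
        \<longlonglongrightarrow> complex_of_real (exp (- s\<^sup>2 * (LINT \<omega>|M. (path_integral \<omega>)\<^sup>2) / 2))"
      using gaussian_rv_char[OF prob_space_axioms gL cL] by simp
    show ?thesis by (rule LIMSEQ_unique[OF lim1 lim2])
  qed
qed

end

section \<open>Excursions of a Gaussian field\<close>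

text \<open>
  \<open>p\<close> and \<open>a\<close> are the coefficients of the indicator along the Hermite polynomials 1 and
  \<open>x\<close>, so the remainder has Hermite rank at least two. The bound on \<open>a\<close> is the
  Cauchy-Schwarz inequality; with it the remainder grows at most linearly.
\<close>

lemma linear_remainder_of_indicator:
  fixes A :: "real set"
  defines "p \<equiv> measure std_normal_distribution A"
    and "a \<equiv> (LINT x|std_normal_distribution. x * indicator A x)"
  assumes A[measurable]: "A \<in> sets borel"
  shows "\<bar>a\<bar> \<le> 1"
    and "\<bar>indicator A y - p - a * y\<bar> \<le> 1 + \<bar>y\<bar>"
    and "(LINT x|std_normal_distribution. indicator A x - p - a * x) = 0"
    and "(LINT x|std_normal_distribution. x * (indicator A x - p - a * x)) = 0"
proof -
  interpret N: prob_space std_normal_distribution by (rule prob_space_normal_density) simp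
  note mom = integrable_std_normal_distribution_moment
  have ind: "integrable std_normal_distribution (indicat_real A)"
    by (rule N.integrable_const_bound[where B=1]) auto
  have ind2: "integrable std_normal_distribution (\<lambda>x. (indicat_real A x)\<^sup>2)"
    by (rule N.integrable_const_bound[where B=1]) (auto simp: indicator_def)
  have x: "integrable std_normal_distribution (\<lambda>x. x)" "(LINT x|std_normal_distribution. x) = 0"
    using mom[of 1] integral_std_normal_distribution_moment_odd[of 1] by simp_all
  have x2: "integrable std_normal_distribution (\<lambda>x. x\<^sup>2)" "(LINT x|std_normal_distribution. x\<^sup>2) = 1"
    using mom[of 2] std_normal_distribution_even_moments(1)[of 1] by simp_all
  have xind: "integrable std_normal_distribution (\<lambda>x. x * indicat_real A x)"
    by (rule square_integrable_mult[OF _ _ x2(1) ind2]) auto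
  have "\<bar>a\<bar> \<le> sqrt (LINT x|std_normal_distribution. x\<^sup>2)
             * sqrt (LINT x|std_normal_distribution. (indicat_real A x)\<^sup>2)"
    unfolding a_def by (rule integral_Cauchy_Schwarz[OF _ _ x2(1) ind2]) auto
  also have "(LINT x|std_normal_distribution. (indicat_real A x)\<^sup>2) = p"
  proof -
    have "(indicat_real A x)\<^sup>2 = indicat_real A x" for x by (simp add: indicator_def)
    then show ?thesis unfolding p_def by simp
  qed
  also have "sqrt (LINT x|std_normal_distribution. x\<^sup>2) * sqrt p \<le> 1"
    using x2(2) by (simp add: p_def)
  finally show a1: "\<bar>a\<bar> \<le> 1" .
  have p: "0 \<le> p" "p \<le> 1" by (simp_all add: p_def)
  then have "\<bar>indicator A y - p\<bar> \<le> 1" by (auto simp: indicator_def)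
  moreover have "\<bar>a * y\<bar> \<le> \<bar>y\<bar>" using a1 by (simp add: abs_mult mult_left_le_one_le)
  ultimately show "\<bar>indicator A y - p - a * y\<bar> \<le> 1 + \<bar>y\<bar>"
    using abs_triangle_ineq4[of "indicator A y - p" "a * y"] by linarith
  show "(LINT x|std_normal_distribution. indicator A x - p - a * x) = 0"
    using ind x N.prob_space by (simp add: p_def)
  have "(LINT x|std_normal_distribution. x * (indicator A x - p - a * x))
      = (LINT x|std_normal_distribution. x * indicator A x - p * x - a * x\<^sup>2)"
    by (intro Bochner_Integration.integral_cong) (auto simp: algebra_simps power2_eq_square)
  also have "\<dots> = 0" using xind x x2 by (simp add: a_def)
  finally show "(LINT x|std_normal_distribution. x * (indicator A x - p - a * x)) = 0" .
qed

locale gaussian_excursion = prob_space M for M :: "'w measure" +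
  fixes Y :: "'t::topological_space \<Rightarrow> 'w \<Rightarrow> real" and \<sigma> :: "'t \<Rightarrow> real"
    and f :: "real \<Rightarrow> real" and u :: real
  assumes meas: "measurable_field M Y"
    and gauss: "gaussian_field M Y"
    and centered: "\<And>t. (LINT \<omega>|M. Y t \<omega>) = 0"
    and \<sigma>: "\<And>t. \<sigma> t = sqrt (LINT \<omega>|M. (Y t \<omega>)\<^sup>2)"
    and \<sigma>_pos: "\<And>t. \<sigma> t > 0"
    and f [measurable]: "f \<in> borel_measurable borel"
begin

definition Z :: "'t \<Rightarrow> 'w \<Rightarrow> real" where
  "Z t \<omega> = Y t \<omega> / \<sigma> t"

definition exceed :: "'t \<Rightarrow> real set" where
  "exceed t = {x. f (\<sigma> t * x) \<ge> u}"

definition p :: "'t \<Rightarrow> real" where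
  "p t = measure std_normal_distribution (exceed t)"

definition a :: "'t \<Rightarrow> real" where
  "a t = (LINT x|std_normal_distribution. x * indicator (exceed t) x)"

definition corr :: "'t \<Rightarrow> 't \<Rightarrow> real" where
  "corr t s = (LINT \<omega>|M. Z t \<omega> * Z s \<omega>)"

definition remainder :: "'t \<Rightarrow> real \<Rightarrow> real" where
  "remainder t x = indicator (exceed t) x - p t - a t * x"

lemma measurable_Y [measurable]: "(\<lambda>q. Y (fst q) (snd q)) \<in> borel_measurable (borel \<Otimes>\<^sub>M M)"
  using meas by (simp add: measurable_field_def case_prod_unfold)

lemma measurable_Y_compose [measurable (raw)]:
  assumes "g \<in> measurable N borel" "h \<in> measurable N M"
  shows "(\<lambda>q. Y (g q) (h q)) \<in> borel_measurable N"
  using measurable_compose[OF measurable_Pair[OF assms] measurable_Y] by simp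

lemma measurable_\<sigma> [measurable]: "\<sigma> \<in> borel_measurable borel"
proof -
  have "\<sigma> = (\<lambda>t. sqrt (LINT \<omega>|M. (Y t \<omega>)\<^sup>2))" using \<sigma> by auto
  also have "\<dots> \<in> borel_measurable borel" by measurable
  finally show ?thesis .
qed

lemma measurable_Z [measurable (raw)]:
  assumes [measurable]: "g \<in> measurable N borel" "h \<in> measurable N M"
  shows "(\<lambda>q. Z (g q) (h q)) \<in> borel_measurable N"
  unfolding Z_def by measurable

lemma measurable_exceed [measurable (raw)]:
  assumes [measurable]: "g \<in> measurable N borel" "h \<in> borel_measurable N"
  shows "(\<lambda>q. indicat_real (exceed (g q)) (h q)) \<in> borel_measurable N"
  unfolding exceed_def indicator_def mem_Collect_eq by measurable

lemma exceed_sets [measurable]: "exceed t \<in> sets borel"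
  unfolding exceed_def by measurable

lemma p_eq: "p t = (LINT x|std_normal_distribution. indicator (exceed t) x)"
  unfolding p_def by simp

lemma p_bounds: "0 \<le> p t" "p t \<le> 1"
  unfolding p_def
  by (simp_all add: prob_space.prob_le_1 prob_space_normal_density)

lemma sigma_finite_std: "sigma_finite_measure std_normal_distribution"
  by (intro prob_space_imp_sigma_finite prob_space_normal_density) simp

lemma measurable_p [measurable]: "p \<in> borel_measurable borel"
proof -
  interpret sigma_finite_measure std_normal_distribution by (rule sigma_finite_std)
  show ?thesis unfolding p_eq[abs_def] by measurable
qed

lemma measurable_a [measurable]: "a \<in> borel_measurable borel"
proof -
  interpret sigma_finite_measure std_normal_distribution by (rule sigma_finite_std)
  show ?thesis unfolding a_def[abs_def] by measurable
qed

lemma measurable_corr [measurable (raw)]: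
  assumes [measurable]: "g \<in> measurable N borel" "h \<in> measurable N borel"
  shows "(\<lambda>q. corr (g q) (h q)) \<in> borel_measurable N"
  unfolding corr_def by measurable

lemma measurable_remainder [measurable (raw)]:
  assumes [measurable]: "g \<in> measurable N borel" "h \<in> borel_measurable N"
  shows "(\<lambda>q. remainder (g q) (h q)) \<in> borel_measurable N"
  unfolding remainder_def by measurable

lemma gaussian_rv_Z_pair: "gaussian_rv M (\<lambda>\<omega>. b * Z t \<omega> + c * Z s \<omega>)"
proof (cases "t = s")
  case True
  have "gaussian_rv M (\<lambda>\<omega>. \<Sum>x\<in>{t}. (b + c) / \<sigma> t * Y x \<omega>)"
    by (rule gauss[unfolded gaussian_field_def, rule_format]) simp
  then show ?thesis using True by (simp add: Z_def distrib_right add_divide_distrib)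
next
  case False
  have "gaussian_rv M (\<lambda>\<omega>. \<Sum>x\<in>{t, s}. (if x = t then b / \<sigma> t else c / \<sigma> s) * Y x \<omega>)"
    by (rule gauss[unfolded gaussian_field_def, rule_format]) simp
  then show ?thesis using False by (simp add: Z_def)
qed

lemma gaussian_rv_Z: "gaussian_rv M (Z t)"
  using gaussian_rv_Z_pair[of 1 t 0 t] by simp

lemma Z_centered: "(LINT \<omega>|M. Z t \<omega>) = 0"
  unfolding Z_def using centered[of t] by simp

lemma Z_square: "integrable M (\<lambda>\<omega>. (Z t \<omega>)\<^sup>2)" "(LINT \<omega>|M. (Z t \<omega>)\<^sup>2) = 1"
proof -
  show "integrable M (\<lambda>\<omega>. (Z t \<omega>)\<^sup>2)"
    by (rule gaussian_rv_square_integrable[OF prob_space_axioms gaussian_rv_Z Z_centered])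
  have "0 \<le> (LINT \<omega>|M. (Y t \<omega>)\<^sup>2)" by (rule Bochner_Integration.integral_nonneg) simp
  then have "(LINT \<omega>|M. (Y t \<omega>)\<^sup>2) = (\<sigma> t)\<^sup>2" unfolding \<sigma> by simp
  then show "(LINT \<omega>|M. (Z t \<omega>)\<^sup>2) = 1"
    using \<sigma>_pos[of t] by (simp add: Z_def power_divide)
qed

lemma Z_integrable: "integrable M (Z t)"
  using square_integrable_mult[of "\<lambda>_. 1" M "Z t"] Z_square[of t] by simp

lemma Z_mult_integrable: "integrable M (\<lambda>\<omega>. Z t \<omega> * Z s \<omega>)"
  by (rule square_integrable_mult) (auto intro: Z_square)

lemma corr_le_1: "\<bar>corr t s\<bar> \<le> 1"
  using integral_Cauchy_Schwarz[of "Z t" M "Z s"] Z_square by (simp add: corr_def)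

lemma correlation_eq_corr: "correlation M (Y t) (Y s) = corr t s"
proof -
  have cov: "covariance M (Y t) (Y s) = \<sigma> t * \<sigma> s * corr t s" for t s
  proof -
    have "\<sigma> t \<noteq> 0" "\<sigma> s \<noteq> 0" using \<sigma>_pos[of t] \<sigma>_pos[of s] by auto
    then show ?thesis
      by (simp add: covariance_def centered corr_def Z_def)
  qed
  have "corr t t = 1" for t using Z_square[of t] by (simp add: corr_def power2_eq_square)
  then show ?thesis
    using \<sigma>_pos[of t] \<sigma>_pos[of s]
    by (simp add: correlation_def cov real_sqrt_mult)
qed

lemma char_Z_pair:
  "(CLINT \<omega>|M. iexp (b * Z t \<omega> + c * Z s \<omega>))
     = complex_of_real (exp (- (b\<^sup>2 + 2 * corr t s * b * c + c\<^sup>2) / 2))"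
proof -
  have m: "(LINT \<omega>|M. b * Z t \<omega> + c * Z s \<omega>) = 0"
    using Z_integrable Z_centered by simp
  have "(LINT \<omega>|M. (b * Z t \<omega> + c * Z s \<omega>)\<^sup>2)
      = (LINT \<omega>|M. b\<^sup>2 * (Z t \<omega>)\<^sup>2 + 2 * b * c * (Z t \<omega> * Z s \<omega>) + c\<^sup>2 * (Z s \<omega>)\<^sup>2)"
    by (intro Bochner_Integration.integral_cong) (auto simp: power2_sum power_mult_distrib)
  also have "\<dots> = b\<^sup>2 + 2 * corr t s * b * c + c\<^sup>2"
    using Z_square Z_mult_integrable[of t s] by (simp add: corr_def)
  finally show ?thesis
    using gaussian_rv_char[OF prob_space_axioms gaussian_rv_Z_pair m, of 1] by simp
qed

lemma distr_Z: "distr M borel (Z t) = std_normal_distribution"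
proof (rule Levy_uniqueness)
  show "char (distr M borel (Z t)) = char std_normal_distribution"
  proof
    fix s
    have "char (distr M borel (Z t)) s = (CLINT \<omega>|M. iexp (s * Z t \<omega>))"
      unfolding char_def by (subst integral_distr) auto
    also have "\<dots> = complex_of_real (exp (- s\<^sup>2 / 2))"
      using char_Z_pair[of s t 0 t] by simp
    finally show "char (distr M borel (Z t)) s = char std_normal_distribution s"
      by (simp add: char_std_normal_distribution)
  qed
qed (auto intro: real_dist_normal_dist)

lemma exceed_Z: "Z t \<omega> \<in> exceed t \<longleftrightarrow> f (Y t \<omega>) \<ge> u"
  using \<sigma>_pos[of t] by (simp add: exceed_def Z_def)

lemma prob_exceed: "measure M {\<omega> \<in> space M. f (Y t \<omega>) \<ge> u} = p t"
proof -
  have "p t = measure M (Z t -` exceed t \<inter> space M)"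
    unfolding p_def distr_Z[symmetric, of t] by (rule measure_distr) auto
  also have "Z t -` exceed t \<inter> space M = {\<omega> \<in> space M. f (Y t \<omega>) \<ge> u}"
    by (auto simp: exceed_Z)
  finally show ?thesis by simp
qed

lemmas a_le_1 = linear_remainder_of_indicator(1)[OF exceed_sets, folded a_def]
lemmas remainder_growth =
  linear_remainder_of_indicator(2)[OF exceed_sets, folded p_def a_def, folded remainder_def]
lemmas remainder_orth =
  linear_remainder_of_indicator(3,4)[OF exceed_sets, folded p_def a_def, folded remainder_def]

lemma remainder_covariance:
  "\<bar>LINT \<omega>|M. remainder t (Z t \<omega>) * remainder s (Z s \<omega>)\<bar> \<le> 2000 * (corr t s)\<^sup>2"
  by (rule rank_two_covariance_bound[OF prob_space_axioms _ _ Z_square Z_square char_Z_pair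
        _ _ remainder_growth remainder_growth remainder_orth]) measurable

lemma remainder_square:
  shows "integrable M (\<lambda>\<omega>. (remainder t (Z t \<omega>))\<^sup>2)"
    and "(LINT \<omega>|M. (remainder t (Z t \<omega>))\<^sup>2) \<le> 4"
proof -
  have le: "(remainder t x)\<^sup>2 \<le> 2 + 2 * x\<^sup>2" for x
  proof -
    have "\<bar>remainder t x\<bar>\<^sup>2 \<le> (1 + \<bar>x\<bar>)\<^sup>2" by (intro power_mono remainder_growth) simp
    also have "\<dots> \<le> 2 + 2 * x\<^sup>2"
      using zero_le_power2[of "1 - \<bar>x\<bar>"] by (simp add: power2_diff power2_sum)
    finally show ?thesis by simp
  qed
  have int: "integrable M (\<lambda>\<omega>. 2 + 2 * (Z t \<omega>)\<^sup>2)" using Z_square[of t] by simp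
  show i: "integrable M (\<lambda>\<omega>. (remainder t (Z t \<omega>))\<^sup>2)"
    by (rule Bochner_Integration.integrable_bound[OF int]) (use le in \<open>auto intro!: AE_I2\<close>)
  have "(LINT \<omega>|M. (remainder t (Z t \<omega>))\<^sup>2) \<le> (LINT \<omega>|M. 2 + 2 * (Z t \<omega>)\<^sup>2)"
    by (rule integral_mono[OF i int le])
  also have "\<dots> = 4" using Z_square[of t] by (simp add: prob_space)
  finally show "(LINT \<omega>|M. (remainder t (Z t \<omega>))\<^sup>2) \<le> 4" .
qed

lemma linear_part_square:
  shows "integrable M (\<lambda>\<omega>. (a t * Z t \<omega>)\<^sup>2)" and "(LINT \<omega>|M. (a t * Z t \<omega>)\<^sup>2) \<le> 1"
proof -
  show "integrable M (\<lambda>\<omega>. (a t * Z t \<omega>)\<^sup>2)"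
    unfolding power_mult_distrib by (rule integrable_mult_right[OF Z_square(1)])
  have "(a t)\<^sup>2 \<le> 1\<^sup>2" by (rule power2_le_iff_abs_le[THEN iffD2]) (use a_le_1[of t] in auto)
  then show "(LINT \<omega>|M. (a t * Z t \<omega>)\<^sup>2) \<le> 1"
    unfolding power_mult_distrib using Z_square[of t] by simp
qed

lemma gaussian_field_linear_part: "gaussian_field M (\<lambda>t \<omega>. a t * Z t \<omega>)"
  unfolding gaussian_field_def
proof (intro allI impI)
  fix T :: "'t set" and c assume "finite T"
  then have "gaussian_rv M (\<lambda>\<omega>. \<Sum>t\<in>T. (c t * a t / \<sigma> t) * Y t \<omega>)"
    by (rule gauss[unfolded gaussian_field_def, rule_format])
  then show "gaussian_rv M (\<lambda>\<omega>. \<Sum>t\<in>T. c t * (a t * Z t \<omega>))" by (simp add: Z_def mult.assoc)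
qed

end

section \<open>One window: a normal variable plus a small remainder\<close>

locale gaussian_excursion_window = gaussian_excursion M Y \<sigma> f u + \<mu>: finite_measure \<mu>
  for M :: "'w measure" and Y :: "'t::topological_space \<Rightarrow> 'w \<Rightarrow> real" and \<sigma> f u
    and \<mu> :: "'t measure" +
  assumes sets_\<mu> [measurable_cong]: "sets \<mu> = sets borel"
begin

lemma space_\<mu>: "space \<mu> = UNIV"
  using sets_eq_imp_space_eq[OF sets_\<mu>] by simp

sublocale lin: L2_bounded_field M \<mu> "\<lambda>t \<omega>. a t * Z t \<omega>" 1
proof unfold_locales
  show "(\<lambda>(t, \<omega>). a t * Z t \<omega>) \<in> borel_measurable (\<mu> \<Otimes>\<^sub>M M)"
    unfolding case_prod_unfold by measurable
qed (fact space_\<mu> linear_part_square)+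

sublocale rest: L2_bounded_field M \<mu> "\<lambda>t \<omega>. remainder t (Z t \<omega>)" 4
proof unfold_locales
  show "(\<lambda>(t, \<omega>). remainder t (Z t \<omega>)) \<in> borel_measurable (\<mu> \<Otimes>\<^sub>M M)"
    unfolding case_prod_unfold by measurable
qed (fact space_\<mu> remainder_square)+

definition volume :: "'w \<Rightarrow> real" where
  "volume \<omega> = (LINT t|\<mu>. indicator (exceed t) (Z t \<omega>)) - (LINT t|\<mu>. p t)"

lemma measurable_volume [measurable]: "volume \<in> borel_measurable M"
  unfolding volume_def[abs_def] by measurable

lemma volume_decomposition: "AE \<omega> in M. volume \<omega> - lin.path_integral \<omega> = rest.path_integral \<omega>"
  using lin.AE_integrable_path AE_space
proof eventually_elim
  case (elim \<omega>)
  then have [measurable]: "\<omega> \<in> space M" by simp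
  have ind: "integrable \<mu> (\<lambda>t. indicat_real (exceed t) (Z t \<omega>))"
  proof (rule \<mu>.integrable_const_bound[where B=1])
    show "(\<lambda>t. indicat_real (exceed t) (Z t \<omega>)) \<in> borel_measurable \<mu>" by measurable
  qed simp
  have "integrable \<mu> p"
    by (rule \<mu>.integrable_const_bound[where B=1]) (use p_bounds in auto)
  moreover have "rest.path_integral \<omega> = (LINT t|\<mu>. indicator (exceed t) (Z t \<omega>) - p t - a t * Z t \<omega>)"
    unfolding rest.path_integral_def by (simp only: remainder_def)
  ultimately show ?case
    using ind elim(1) by (simp add: volume_def lin.path_integral_def)
qed

definition lin_var :: real where
  "lin_var = (LINT s|\<mu>. LINT t|\<mu>. a t * a s * corr t s)"

definition corr_sq :: real where
  "corr_sq = (LINT s|\<mu>. LINT t|\<mu>. (corr t s)\<^sup>2)"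

lemma second_moment_lin: "(LINT \<omega>|M. (lin.path_integral \<omega>)\<^sup>2) = lin_var"
  unfolding lin.second_moment_path_integral(2) lin_var_def corr_def integral_mult_right_zero[symmetric]
  by (simp add: mult_ac)

lemma lin_var_nonneg: "lin_var \<ge> 0"
  unfolding second_moment_lin[symmetric] by (rule Bochner_Integration.integral_nonneg) simp

lemma second_moment_rest: "(LINT \<omega>|M. (rest.path_integral \<omega>)\<^sup>2) \<le> 2000 * corr_sq"
proof -
  have sq: "(corr t s)\<^sup>2 \<le> 1" for t s
    using power_mono[OF corr_le_1 abs_ge_zero, of t s 2] by simp
  have i1: "integrable \<mu> (\<lambda>t. (corr t s)\<^sup>2)" for s
    by (rule \<mu>.integrable_const_bound[where B=1]) (use sq in auto)
  have le: "(LINT t|\<mu>. (corr t s)\<^sup>2) \<le> measure \<mu> (space \<mu>)" for s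
  proof -
    have "(LINT t|\<mu>. (corr t s)\<^sup>2) \<le> (LINT t|\<mu>. 1)" by (rule integral_mono[OF i1 _ sq]) simp
    then show ?thesis by simp
  qed
  have i2: "integrable \<mu> (\<lambda>s. LINT t|\<mu>. (corr t s)\<^sup>2)"
    by (rule \<mu>.integrable_const_bound[where B="measure \<mu> (space \<mu>)"])
       (use le in \<open>auto simp: Bochner_Integration.integral_nonneg\<close>)
  have b: "(LINT \<omega>|M. remainder t (Z t \<omega>) * remainder s (Z s \<omega>)) \<le> 2000 * (corr t s)\<^sup>2" for t s
    using remainder_covariance[of t s] by linarith
  have "(LINT s|\<mu>. LINT t|\<mu>. LINT \<omega>|M. remainder t (Z t \<omega>) * remainder s (Z s \<omega>))
      \<le> (LINT s|\<mu>. 2000 * (LINT t|\<mu>. (corr t s)\<^sup>2))"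
  proof (rule integral_mono'[OF integrable_mult_right[OF i2]])
    fix s
    have "(LINT t|\<mu>. LINT \<omega>|M. remainder t (Z t \<omega>) * remainder s (Z s \<omega>))
        \<le> (LINT t|\<mu>. 2000 * (corr t s)\<^sup>2)"
      by (rule integral_mono'[OF integrable_mult_right[OF i1] b]) simp
    then show "(LINT t|\<mu>. LINT \<omega>|M. remainder t (Z t \<omega>) * remainder s (Z s \<omega>))
        \<le> 2000 * (LINT t|\<mu>. (corr t s)\<^sup>2)" by simp
  qed (simp add: Bochner_Integration.integral_nonneg)
  then show ?thesis unfolding rest.second_moment_path_integral(2) corr_sq_def by simp
qed

text \<open>
  After normalisation the linear part is exactly standard normal, and the remainder part has second
  moment at most \<open>2000 * corr_sq / lin_var\<close>.
\<close>

lemma char_normalized_volume: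
  assumes "lin_var \<noteq> 0"
  shows "cmod (char (distr M borel (\<lambda>\<omega>. volume \<omega> / sqrt lin_var)) s - char std_normal_distribution s)
           \<le> \<bar>s\<bar> * sqrt (2000 * (corr_sq / lin_var))"
proof -
  define v where "v = lin_var"
  have v: "v > 0" using assms lin_var_nonneg unfolding v_def by simp
  have char1: "char (distr M borel (\<lambda>\<omega>. volume \<omega> / sqrt v)) s
      = (CLINT \<omega>|M. iexp (s * (volume \<omega> / sqrt v)))"
    unfolding char_def by (subst integral_distr) auto
  have cent: "(LINT \<omega>|M. a t * Z t \<omega>) = 0" for t using Z_centered[of t] by simp
  have "(CLINT \<omega>|M. iexp (s * (lin.path_integral \<omega> / sqrt v)))
      = (CLINT \<omega>|M. iexp ((s / sqrt v) * lin.path_integral \<omega>))" by simp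
  also have "\<dots> = complex_of_real (exp (- (s / sqrt v)\<^sup>2 * v / 2))"
    unfolding lin.gaussian_char_path_integral[OF gaussian_field_linear_part cent] second_moment_lin v_def ..
  also have "\<dots> = char std_normal_distribution s"
    using v by (simp add: char_std_normal_distribution power_divide)
  finally have char2: "char std_normal_distribution s
      = (CLINT \<omega>|M. iexp (s * (lin.path_integral \<omega> / sqrt v)))" ..
  have AE: "AE \<omega> in M. (volume \<omega> / sqrt v - lin.path_integral \<omega> / sqrt v)\<^sup>2 = (rest.path_integral \<omega>)\<^sup>2 / v"
    using volume_decomposition
  proof eventually_elim
    case (elim \<omega>)
    show ?case using v by (simp flip: diff_divide_distrib add: elim power_divide)
  qed
  have int: "integrable M (\<lambda>\<omega>. (volume \<omega> / sqrt v - lin.path_integral \<omega> / sqrt v)\<^sup>2)"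
    by (subst integrable_cong_AE[OF _ _ AE]) (auto intro: rest.square_integrable_path_integral)
  have "(LINT \<omega>|M. (volume \<omega> / sqrt v - lin.path_integral \<omega> / sqrt v)\<^sup>2) = (LINT \<omega>|M. (rest.path_integral \<omega>)\<^sup>2 / v)"
    by (rule integral_cong_AE[OF _ _ AE]) auto
  also have "\<dots> = (LINT \<omega>|M. (rest.path_integral \<omega>)\<^sup>2) / v" by simp
  also have "\<dots> \<le> 2000 * corr_sq / v"
    using second_moment_rest v by (simp add: divide_right_mono)
  finally have le: "(LINT \<omega>|M. (volume \<omega> / sqrt v - lin.path_integral \<omega> / sqrt v)\<^sup>2) \<le> 2000 * (corr_sq / v)"
    by simp
  have "cmod ((CLINT \<omega>|M. iexp (s * (volume \<omega> / sqrt v))) - (CLINT \<omega>|M. iexp (s * (lin.path_integral \<omega> / sqrt v))))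
      \<le> \<bar>s\<bar> * sqrt (LINT \<omega>|M. (volume \<omega> / sqrt v - lin.path_integral \<omega> / sqrt v)\<^sup>2)"
    by (rule char_diff_bound[OF prob_space_axioms _ _ int]) measurable
  also have "\<dots> \<le> \<bar>s\<bar> * sqrt (2000 * (corr_sq / v))"
    by (intro mult_left_mono real_sqrt_le_mono le) simp
  finally show ?thesis unfolding char2 char1[unfolded v_def] v_def .
qed

end

section \<open>The limit along the windows\<close>

lemma set_integral_eq_integral_density:
  fixes h :: "'a \<Rightarrow> real"
  assumes [measurable]: "A \<in> sets N" "h \<in> borel_measurable N"
  shows "(LINT t:A|N. h t) = (LINT t|density N (\<lambda>t. ennreal (indicat_real A t)). h t)"
  unfolding set_lebesgue_integral_def by (subst integral_density) auto

theorem theorem2p1: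
  fixes M :: "'w measure"
    and Y X :: "real ^ 'd::finite \<Rightarrow> 'w \<Rightarrow> real"
    and \<sigma> a1 :: "real ^ 'd \<Rightarrow> real"
    and \<rho> :: "real ^ 'd \<Rightarrow> real ^ 'd \<Rightarrow> real"
    and f :: "real \<Rightarrow> real"
    and W :: "nat \<Rightarrow> (real ^ 'd) set"
    and U :: "(real ^ 'd) set"
    and u :: real
  assumes "prob_space M"
    and "measurable_field M Y"
    and "gaussian_field M Y"
    and "\<And>t. (LINT \<omega>|M. Y t \<omega>) = 0"
    and "\<And>t. \<sigma> t = sqrt (LINT \<omega>|M. (Y t \<omega>)\<^sup>2)"
    and "\<And>t. \<sigma> t > 0"
    and "\<And>t s. \<rho> t s = correlation M (Y t) (Y s)"
    and "f \<in> borel_measurable borel"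
    and "\<And>t \<omega>. X t \<omega> = f (Y t \<omega>)"
    and "van_hove W"
    and "\<And>t. a1 t = gauss_inner hermite1 (indicat_real {x. f (\<sigma> t * x) \<ge> u})"
    and "U \<in> sets lebesgue"
    and "\<And>n. n \<ge> 1 \<Longrightarrow> U \<subseteq> W n"
    and "measure lebesgue U > 0"
    and "\<And>t. t \<in> U \<Longrightarrow> a1 t \<noteq> 0"
    \<comment> \<open>The quotients below are eventually genuine ones (division by zero is path_integral in HOL).\<close>
    and "\<forall>\<^sub>F n in sequentially.
           (LINT s:W n|lborel. (LINT t:W n|lborel. a1 t * a1 s * \<rho> t s)) \<noteq> 0"
    and "(\<lambda>n. (LINT s:W n|lborel. (LINT t:W n|lborel. (\<rho> t s)\<^sup>2))
             / (LINT s:W n|lborel. (LINT t:W n|lborel. a1 t * a1 s * \<rho> t s)))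
           \<longlonglongrightarrow> 0"
  shows "weak_conv_m
           (\<lambda>n. distr M borel (\<lambda>\<omega>.
              ((LINT t:W n|lborel. indicat_real {\<eta> \<in> space M. X t \<eta> \<ge> u} \<omega>)
                 - (LINT t:W n|lborel. measure M {\<eta> \<in> space M. X t \<eta> \<ge> u}))
              / sqrt (LINT s:W n|lborel. (LINT t:W n|lborel. a1 t * a1 s * \<rho> t s))))
           std_normal_distribution"
proof -
  interpret G: gaussian_excursion M Y \<sigma> f u
    by (intro gaussian_excursion.intro gaussian_excursion_axioms.intro assms)
  have a1: "a1 t = G.a t" for t
    unfolding assms(11) gauss_inner_def hermite1_def G.a_def G.exceed_def
    by (subst integral_density) (auto simp: mult_ac)
  have \<rho>: "\<rho> t s = G.corr t s" for t s
    unfolding assms(7) by (rule G.correlation_eq_corr)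
  \<comment> \<open>Compactness is known from index 1 on, so the sequence is shifted by one; window 0 need not be measurable.\<close>
  define \<mu> where "\<mu> n = density lborel (\<lambda>t. ennreal (indicat_real (W (Suc n)) t))" for n
  have W: "compact (W (Suc n))" for n using assms(10) unfolding van_hove_def by simp
  have W_sets [measurable]: "W (Suc n) \<in> sets borel" for n by (intro borel_compact W)
  have window: "gaussian_excursion_window M Y \<sigma> f (\<mu> n)" for n
  proof (intro gaussian_excursion_window.intro gaussian_excursion_window_axioms.intro
      G.gaussian_excursion_axioms finite_measureI)
    have "emeasure (\<mu> n) (space (\<mu> n)) = emeasure lborel (W (Suc n))"
      unfolding \<mu>_def by (subst emeasure_density) (auto simp: ennreal_indicator)
    also have "\<dots> < \<infinity>" by (intro emeasure_bounded_finite compact_imp_bounded W)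
    finally show "emeasure (\<mu> n) (space (\<mu> n)) \<noteq> \<infinity>" by simp
  qed (simp add: \<mu>_def)
  interpret E: gaussian_excursion_window M Y \<sigma> f u "\<mu> n" for n by (rule window)
  note to_\<mu> = set_integral_eq_integral_density[of "W (Suc n)" lborel for n, folded \<mu>_def]
  have D: "(LINT s:W (Suc n)|lborel. (LINT t:W (Suc n)|lborel. a1 t * a1 s * \<rho> t s)) = E.lin_var n" for n
  proof -
    have *: "(LINT t:W (Suc n)|lborel. G.a t * G.a s * G.corr t s)
        = (LINT t|\<mu> n. G.a t * G.a s * G.corr t s)" for s
      by (rule to_\<mu>) auto
    show ?thesis unfolding a1 \<rho> * E.lin_var_def by (rule to_\<mu>) auto
  qed
  have V: "(LINT s:W (Suc n)|lborel. (LINT t:W (Suc n)|lborel. (\<rho> t s)\<^sup>2)) = E.corr_sq n" for n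
  proof -
    have *: "(LINT t:W (Suc n)|lborel. (G.corr t s)\<^sup>2) = (LINT t|\<mu> n. (G.corr t s)\<^sup>2)" for s
      by (rule to_\<mu>) auto
    show ?thesis unfolding \<rho> * E.corr_sq_def by (rule to_\<mu>) auto
  qed
  have S: "(LINT t:W (Suc n)|lborel. indicat_real {\<eta> \<in> space M. X t \<eta> \<ge> u} \<omega>)
        - (LINT t:W (Suc n)|lborel. measure M {\<eta> \<in> space M. X t \<eta> \<ge> u}) = E.volume n \<omega>"
    if \<omega>[measurable]: "\<omega> \<in> space M" for n \<omega>
  proof -
    have "indicat_real {\<eta> \<in> space M. X t \<eta> \<ge> u} \<omega> = indicat_real (G.exceed t) (G.Z t \<omega>)" for t
      using \<omega> by (simp add: indicator_def G.exceed_Z assms(9))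
    moreover have "measure M {\<eta> \<in> space M. X t \<eta> \<ge> u} = G.p t" for t
      unfolding assms(9) by (rule G.prob_exceed)
    ultimately show ?thesis unfolding E.volume_def using \<omega> by (simp add: to_\<mu>)
  qed
  let ?law = "\<lambda>n. distr M borel (\<lambda>\<omega>. E.volume n \<omega> / sqrt (E.lin_var n))"
  have "weak_conv_m ?law std_normal_distribution"
  proof (rule levy_continuity)
    show "real_distribution (?law n)" for n by (rule G.real_distribution_distr) simp
    fix s
    have "(\<lambda>n. E.corr_sq n / E.lin_var n) \<longlonglongrightarrow> 0"
      using LIMSEQ_Suc[OF assms(17)] unfolding D V .
    then have "(\<lambda>n. \<bar>s\<bar> * sqrt (2000 * (E.corr_sq n / E.lin_var n))) \<longlonglongrightarrow> \<bar>s\<bar> * sqrt (2000 * 0)"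
      by (intro tendsto_intros)
    then have "(\<lambda>n. \<bar>s\<bar> * sqrt (2000 * (E.corr_sq n / E.lin_var n))) \<longlonglongrightarrow> 0" by simp
    moreover have "\<forall>\<^sub>F n in sequentially. E.lin_var n \<noteq> 0"
      using eventually_sequentially_Suc[THEN iffD2, OF assms(16)] unfolding D .
    then have "\<forall>\<^sub>F n in sequentially. cmod (char (?law n) s - char std_normal_distribution s)
        \<le> \<bar>s\<bar> * sqrt (2000 * (E.corr_sq n / E.lin_var n))"
      by eventually_elim (rule E.char_normalized_volume)
    ultimately have "(\<lambda>n. char (?law n) s - char std_normal_distribution s) \<longlonglongrightarrow> 0"
      by (rule Lim_null_comparison[rotated])
    then show "(\<lambda>n. char (?law n) s) \<longlonglongrightarrow> char std_normal_distribution s"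
      by (rule LIM_zero_cancel)
  qed (rule real_dist_normal_dist)
  moreover have "?law n = distr M borel (\<lambda>\<omega>.
              ((LINT t:W (Suc n)|lborel. indicat_real {\<eta> \<in> space M. X t \<eta> \<ge> u} \<omega>)
                 - (LINT t:W (Suc n)|lborel. measure M {\<eta> \<in> space M. X t \<eta> \<ge> u}))
              / sqrt (LINT s:W (Suc n)|lborel. (LINT t:W (Suc n)|lborel. a1 t * a1 s * \<rho> t s)))" for n
    by (rule distr_cong) (simp_all add: S D)
  ultimately show ?thesis
    unfolding weak_conv_m_def weak_conv_def
    by (auto intro: filterlim_sequentially_Suc[THEN iffD1])
qed

end
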